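(* Let $a$ be a nonzero rational number. (1) The polynomial $x^5+ax^2+x+a$ has no quadratic factor $x^2+px+q$ with $p,q\in\mathbb{Q}$. (2) The polynomial $x^5+ax^4+x+a$ has no quadratic factor $x^2+px+q$ with $p,q\in\mathbb{Q}$.
   Context: All polynomials are in $\mathbb{Q}[x]$; a quadratic factor means a monic quadratic with rational coefficients dividing the polynomial in $\mathbb{Q}[x]$. *)

theory Defs
  imports Complex_Main "HOL-Computational_Algebra.Polynomial"
begin

definition has_quadratic_factor :: "rat poly \<Rightarrow> bool" where
  "has_quadratic_factor f \<longleftrightarrow> (\<exists>p q :: rat. [:q, p, 1:] dvd f)"

end

theory Submission
  imports Defs "HOL-Analysis.Analysis"
begin

text \<open>
  The second polynomial is $(x+a)(x^4+1)$, so only the first one needs work. If $x^2+px+q$ divides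
  it, put $t=q-1$; eliminating $a$ from the vanishing remainder shows that $u=(t^2+p^2-2)/t$ is the
  abscissa of a rational point on the curve $v^2=(u-2)(u^3+5u-2)$, an elliptic curve of conductor 38
  whose group of rational points is cyclic of order 5, namely the points with $u\in\{0,2,\infty\}$.

  This is proved by a 2-descent in $\mathbb{Z}[\theta]$, $\theta^3+5\theta=2$. For $u=m/n$ one has
  $m-2n=c\delta^2$ and $N(m-n\theta)=cs^2$ with $c\in\{1,2\}$ up to a common sign. For $c=2$ the
  element $m-n\theta$ is divisible by $\theta$, of norm 2, so in both cases it has a divisor $\alpha$
  of norm $s^2$. Instead of class group and units, Minkowski's theorem is applied to the ideal
  $(m-n\theta,s)$ with an ellipsoid adapted to the conjugates of $\alpha$: it gives $\beta$ with
  $\beta^2=\alpha\gamma$ and all conjugates of $\gamma$ bounded, so $\gamma$ lies in a short explicit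
  list. All square classes on the list but the trivial one are excluded by congruences modulo 16.
  Hence $c(m-n\theta)$ is a square in the field, the point is twice another point of smaller height,
  and infinite descent applies.
\<close>

section \<open>Minkowski's convex body theorem\<close>

definition int_lattice :: "(real^'n) set" where
  "int_lattice = {v. \<forall>i. v $ i \<in> \<int>}"

definition unit_cell :: "real^'n \<Rightarrow> (real^'n) set" where
  "unit_cell k = {x. \<forall>i. k $ i \<le> x $ i \<and> x $ i < k $ i + 1}"

definition floor_vec :: "real^'n \<Rightarrow> real^'n" where
  "floor_vec x = (\<chi> i. of_int \<lfloor>x $ i\<rfloor>)"

lemma floor_vec_in_int_lattice: "floor_vec x \<in> int_lattice"
  by (simp add: floor_vec_def int_lattice_def)

lemma int_lattice_diff: "v \<in> int_lattice \<Longrightarrow> w \<in> int_lattice \<Longrightarrow> v - w \<in> int_lattice"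
  by (simp add: int_lattice_def)

lemma in_unit_cell_floor_vec: "x \<in> unit_cell (floor_vec x)"
  by (simp add: unit_cell_def floor_vec_def)

lemma unit_cell_translate_subset_cbox: "(\<lambda>x. x - k) ` unit_cell k \<subseteq> cbox 0 (1 :: real^'n)"
  by (auto simp: unit_cell_def mem_box_cart algebra_simps less_imp_le add.commute)

lemma unit_cell_lebesgue_measurable:
  fixes k :: "real^'n"
  shows "unit_cell k \<in> sets lebesgue"
proof -
  have "closed (\<Inter>i. {x :: real^'n. k $ i \<le> x $ i})"
    by (intro closed_INT ballI closed_Collect_le continuous_intros)
  moreover have "open (\<Inter>i. {x :: real^'n. x $ i < k $ i + 1})"
    by (intro open_INT ballI open_Collect_less continuous_intros) auto
  moreover have "unit_cell k = (\<Inter>i. {x. k $ i \<le> x $ i}) \<inter> (\<Inter>i. {x. x $ i < k $ i + 1})"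
    by (auto simp: unit_cell_def)
  ultimately show ?thesis by auto
qed

lemma finite_floor_vec_image:
  fixes S :: "(real^'n) set"
  assumes "bounded S"
  shows "finite (floor_vec ` S)"
proof -
  obtain B where B: "\<And>x. x \<in> S \<Longrightarrow> norm x \<le> B"
    using assms by (auto simp: bounded_iff)
  define J where "J = {\<lfloor>- B\<rfloor>..\<lfloor>B\<rfloor>}"
  have "floor_vec x \<in> (\<lambda>f. \<chi> i. of_int (f i)) ` (UNIV \<rightarrow>\<^sub>E J)" if "x \<in> S" for x
  proof
    have "\<bar>x $ i\<bar> \<le> B" for i
      using B[OF that] component_le_norm_cart order_trans by blast
    then show "(\<lambda>i. \<lfloor>x $ i\<rfloor>) \<in> UNIV \<rightarrow>\<^sub>E J"
      by (auto simp: J_def abs_le_iff intro!: floor_mono) (metis minus_le_iff)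
  qed (simp add: floor_vec_def)
  then have "floor_vec ` S \<subseteq> (\<lambda>f. \<chi> i. of_int (f i)) ` (UNIV \<rightarrow>\<^sub>E J)" by blast
  then show ?thesis
    by (rule finite_subset) (intro finite_imageI finite_PiE; simp add: J_def)
qed

definition moved_piece :: "(real^'n) set \<Rightarrow> real^'n \<Rightarrow> (real^'n) set" where
  "moved_piece S k = (\<lambda>x. x - k) ` (S \<inter> unit_cell k)"

lemma measure_le_1_if_disjoint_moved_pieces:
  fixes S :: "(real^'n) set"
  assumes S: "S \<in> lmeasurable" "bounded S"
    and disjoint: "pairwise (\<lambda>k l. disjnt (moved_piece S k) (moved_piece S l)) (floor_vec ` S)"
  shows "measure lebesgue S \<le> 1"
proof -
  let ?I = "floor_vec ` S" and ?piece = "\<lambda>k. S \<inter> unit_cell k"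
  have finite: "finite ?I" by (rule finite_floor_vec_image[OF S(2)])
  have piece: "?piece k \<in> lmeasurable" for k
    by (rule fmeasurable_Int_fmeasurable[OF S(1) unit_cell_lebesgue_measurable])
  then have moved: "moved_piece S k \<in> lmeasurable" for k
    unfolding moved_piece_def by (rule measurable_translation_subtract)
  have moved_subset: "(\<Union>k\<in>?I. moved_piece S k) \<subseteq> cbox 0 1"
    using unit_cell_translate_subset_cbox unfolding moved_piece_def by blast
  have "S = (\<Union>k\<in>?I. ?piece k)"
    using in_unit_cell_floor_vec by auto
  then have "measure lebesgue S \<le> (\<Sum>k\<in>?I. measure lebesgue (?piece k))"
    using measure_UNION_le[OF finite, of ?piece lebesgue] piece by (auto simp: fmeasurableD)
  also have "\<dots> = (\<Sum>k\<in>?I. measure lebesgue (moved_piece S k))"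
    by (simp add: moved_piece_def measure_translation_subtract)
  also have "\<dots> = measure lebesgue (\<Union>k\<in>?I. moved_piece S k)"
    using measure_UNION'[OF finite moved disjoint] ..
  also have "\<dots> \<le> measure lebesgue (cbox 0 (1 :: real^'n))"
    by (intro measure_mono_fmeasurable moved_subset sets.finite_UN finite fmeasurableD moved
        lmeasurable_cbox)
  also have "\<dots> \<le> 1"
    by (simp add: content_cbox_if_cart)
  finally show ?thesis .
qed

theorem blichfeldt:
  fixes S :: "(real^'n) set"
  assumes S: "S \<in> lmeasurable" "bounded S" and large: "measure lebesgue S > 1"
  obtains x y where "x \<in> S" "y \<in> S" "x \<noteq> y" "x - y \<in> int_lattice"
proof -
  have "\<not> pairwise (\<lambda>k l. disjnt (moved_piece S k) (moved_piece S l)) (floor_vec ` S)"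
    using measure_le_1_if_disjoint_moved_pieces[OF S] large by linarith
  then obtain k l z where kl: "k \<in> floor_vec ` S" "l \<in> floor_vec ` S" "k \<noteq> l"
    and z: "z \<in> moved_piece S k" "z \<in> moved_piece S l"
    by (auto simp: pairwise_def disjnt_iff)
  then obtain x y where xy: "x \<in> S" "y \<in> S" "z = x - k" "z = y - l"
    by (auto simp: moved_piece_def)
  then have "x - y = k - l" by (simp add: algebra_simps)
  moreover have "k - l \<in> int_lattice"
    using kl by (auto intro: int_lattice_diff floor_vec_in_int_lattice)
  ultimately show thesis
    using that xy(1,2) kl(3) by (metis right_minus_eq)
qed

theorem minkowski_convex_body:
  fixes S :: "(real^'n) set"
  assumes "convex S" "bounded S" and symmetric: "\<And>x. x \<in> S \<Longrightarrow> - x \<in> S"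
    and large: "measure lebesgue S > 2 ^ CARD('n)"
  obtains v where "v \<in> S" "v \<in> int_lattice" "v \<noteq> 0"
proof -
  define T where "T = (\<lambda>x. x /\<^sub>R 2) ` S"
  have "measure lebesgue T = measure lebesgue S / 2 ^ CARD('n)"
    using measure_lebesgue_affine[of "1/2" 0 S] by (simp add: T_def power_divide)
  then have "measure lebesgue T > 1"
    using large by simp
  moreover have "convex T" "bounded T"
    using assms(1,2) by (simp_all add: T_def convex_scaling bounded_scaling)
  ultimately obtain x y where "x \<in> T" "y \<in> T" "x \<noteq> y" and lattice: "x - y \<in> int_lattice"
    using blichfeldt measurable_convex by metis
  then obtain a b where ab: "a \<in> S" "b \<in> S"
    and diff: "x - y = (1/2) *\<^sub>R a + (1/2) *\<^sub>R (- b)"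
    by (auto simp: T_def scaleR_diff_right)
  have "x - y \<in> S"
    unfolding diff using ab symmetric by (intro convexD[OF \<open>convex S\<close>]) auto
  then show thesis
    using that lattice \<open>x \<noteq> y\<close> by simp
qed

corollary minkowski_ellipsoid:
  fixes A :: "real^'n::{finite,wellorder}^'n::_"
  assumes det: "det A \<noteq> 0" and r: "r \<ge> 0"
    and large: "2 ^ CARD('n) * \<bar>det A\<bar> < unit_ball_vol (real CARD('n)) * r ^ CARD('n)"
  obtains v where "v \<in> int_lattice" "v \<noteq> 0" "norm (A *v v) \<le> r"
proof -
  obtain B where AB: "A ** B = mat 1"
    using det by (metis invertible_def invertible_det_nz)
  define S where "S = (*v) B ` cball 0 r"
  have "det A * det B = 1"
    using AB by (metis det_I det_mul)
  then have "\<bar>det B\<bar> = 1 / \<bar>det A\<bar>"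
    using det by (metis abs_mult abs_one abs_eq_0 eq_divide_eq mult.commute)
  moreover have "measure lebesgue S
      = \<bar>det B\<bar> * measure lebesgue (cball (0 :: real^'n::{finite,wellorder}) r)"
    unfolding S_def by (simp add: measure_linear_image)
  ultimately have "measure lebesgue S = unit_ball_vol (real CARD('n)) * r ^ CARD('n) / \<bar>det A\<bar>"
    using r by (simp add: content_cball)
  then have "measure lebesgue S > 2 ^ CARD('n)"
    using large det by (simp add: less_divide_eq)
  moreover have "convex S"
    unfolding S_def by (intro convex_linear_image convex_cball) simp
  moreover have "bounded S"
    unfolding S_def
    by (intro bounded_linear_image bounded_cball) (simp add: linear_conv_bounded_linear[symmetric])
  moreover have "- x \<in> S" if "x \<in> S" for x
  proof -
    obtain u where "x = B *v u" "u \<in> cball 0 r" using \<open>x \<in> S\<close> unfolding S_def by blast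
    then show ?thesis
      unfolding S_def by (intro image_eqI[of _ _ "- u"]) (auto simp: vec.neg)
  qed
  ultimately obtain v where v: "v \<in> S" "v \<in> int_lattice" "v \<noteq> 0"
    using minkowski_convex_body by metis
  then obtain u where "v = B *v u" "norm u \<le> r" by (auto simp: S_def)
  then have "norm (A *v v) \<le> r" using AB by (simp add: matrix_vector_mul_assoc)
  then show thesis using that v by blast
qed

section \<open>The cubic ring\<close>

text \<open>\<open>Cub x y z\<close> stands for $x+y\theta+z\theta^2$ with $\theta^3+5\theta=2$.\<close>

datatype cubic = Cub (coord0: int) (coord1: int) (coord2: int)

instantiation cubic :: comm_ring_1
begin

definition zero_cubic where "0 = Cub 0 0 0"
definition one_cubic where "1 = Cub 1 0 0"
definition plus_cubic where
  "a + b = Cub (coord0 a + coord0 b) (coord1 a + coord1 b) (coord2 a + coord2 b)"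
definition minus_cubic where
  "a - b = Cub (coord0 a - coord0 b) (coord1 a - coord1 b) (coord2 a - coord2 b)"
definition uminus_cubic where
  "- a = Cub (- coord0 a) (- coord1 a) (- coord2 a)"
definition times_cubic where
  "a * b = Cub
     (coord0 a * coord0 b + 2 * (coord1 a * coord2 b + coord2 a * coord1 b))
     (coord0 a * coord1 b + coord1 a * coord0 b
       - 5 * (coord1 a * coord2 b + coord2 a * coord1 b) + 2 * (coord2 a * coord2 b))
     (coord0 a * coord2 b + coord1 a * coord1 b + coord2 a * coord0 b
       - 5 * (coord2 a * coord2 b))"

instance
  by standard (auto simp: zero_cubic_def one_cubic_def plus_cubic_def minus_cubic_def
      uminus_cubic_def times_cubic_def algebra_simps)

end

lemma Cub_mult:
  "Cub a b c * Cub x y z = Cub (a * x + 2 * (b * z + c * y))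
     (a * y + b * x - 5 * (b * z + c * y) + 2 * (c * z)) (a * z + b * y + c * x - 5 * (c * z))"
  by (simp add: times_cubic_def)

lemma of_int_cubic: "of_int k = Cub k 0 0"
proof -
  have of_nat: "of_nat j = Cub (int j) 0 0" for j
    by (induction j) (auto intro: cubic.expand simp: zero_cubic_def one_cubic_def plus_cubic_def)
  show ?thesis
    by (cases k) (auto simp: of_nat uminus_cubic_def minus_cubic_def one_cubic_def)
qed

lemma coord_of_int_mult:
  "coord0 (of_int k * a) = k * coord0 a" "coord1 (of_int k * a) = k * coord1 a"
  "coord2 (of_int k * a) = k * coord2 a"
  by (simp_all add: of_int_cubic times_cubic_def)

lemma numeral_cubic: "numeral k = Cub (numeral k) 0 0"
  by (metis of_int_cubic of_int_numeral)

lemma of_int_dvd_Cub_iff: "of_int k dvd Cub x y z \<longleftrightarrow> k dvd x \<and> k dvd y \<and> k dvd z"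
proof
  assume "of_int k dvd Cub x y z"
  then obtain w where "Cub x y z = of_int k * w" by (elim dvdE)
  then show "k dvd x \<and> k dvd y \<and> k dvd z" by (cases w) (simp add: of_int_cubic Cub_mult)
next
  assume "k dvd x \<and> k dvd y \<and> k dvd z"
  then obtain x' y' z' where "x = k * x'" "y = k * y'" "z = k * z'" by (auto elim!: dvdE)
  then have "Cub x y z = of_int k * Cub x' y' z'" by (simp add: of_int_cubic Cub_mult)
  then show "of_int k dvd Cub x y z" by simp
qed

lemma cubic_infinite_descent:
  fixes k :: int and P :: "cubic \<Rightarrow> bool"
  assumes "k > 1" and step: "\<And>a. P a \<Longrightarrow> \<exists>a'. a = of_int k * a' \<and> P a'" and "P a"
  shows "a = 0"
  using \<open>P a\<close>
proof (induction "nat (\<bar>coord0 a\<bar> + \<bar>coord1 a\<bar> + \<bar>coord2 a\<bar>)" arbitrary: a rule: less_induct)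
  case less
  obtain x y z where xyz: "a = of_int k * Cub x y z" "P (Cub x y z)"
    using step[OF less.prems] by (metis cubic.exhaust)
  then have a: "a = Cub (k * x) (k * y) (k * z)"
    by (simp add: of_int_cubic Cub_mult)
  define S where "S = \<bar>x\<bar> + \<bar>y\<bar> + \<bar>z\<bar>"
  have size: "\<bar>coord0 a\<bar> + \<bar>coord1 a\<bar> + \<bar>coord2 a\<bar> = k * S"
    using \<open>k > 1\<close> by (simp add: a S_def abs_mult algebra_simps)
  show ?case
  proof (cases "S = 0")
    case True
    then have "x = 0" "y = 0" "z = 0" by (simp_all add: S_def)
    then show ?thesis by (simp add: a zero_cubic_def)
  next
    case False
    then have "S > 0" by (simp add: S_def)
    then have "nat S < nat (k * S)" using \<open>k > 1\<close> by simp
    then have "Cub x y z = 0" using less.hyps xyz(2) by (simp add: size S_def)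
    then show ?thesis using xyz(1) by simp
  qed
qed

subsection \<open>The norm\<close>

fun cnorm :: "cubic \<Rightarrow> int" where
  "cnorm (Cub x y z) = x^3 + 2 * y^3 + 4 * z^3 - 10 * x\<^sup>2 * z + 5 * x * y\<^sup>2 + 25 * x * z\<^sup>2
     - 6 * x * y * z + 10 * y * z\<^sup>2"

fun cadj :: "cubic \<Rightarrow> cubic" where
  "cadj (Cub x y z) = Cub ((x - 5 * z)\<^sup>2 - y * (2 * z - 5 * y))
     (z * (2 * z - 5 * y) - y * (x - 5 * z)) (y\<^sup>2 - z * (x - 5 * z))"

lemma mult_cadj: "a * cadj a = of_int (cnorm a)"
  by (cases a)
    (simp add: Cub_mult of_int_cubic algebra_simps power2_eq_square power3_eq_cube)

lemma cnorm_mult: "cnorm (a * b) = cnorm a * cnorm b"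
proof -
  obtain x y z u v w where ab: "a = Cub x y z" "b = Cub u v w"
    by (cases a; cases b) blast
  show ?thesis
    unfolding ab Cub_mult cnorm.simps by algebra
qed

lemma cnorm_of_int [simp]: "cnorm (of_int k) = k ^ 3"
  by (simp add: of_int_cubic)

lemma cnorm_power: "cnorm (a ^ k) = cnorm a ^ k"
  by (induction k) (simp_all add: cnorm_mult one_cubic_def)

lemma cnorm_Cub_mod: "cnorm (Cub x y z) mod k = cnorm (Cub (x mod k) (y mod k) (z mod k)) mod k"
  unfolding cnorm.simps power2_eq_square power3_eq_cube
  by (intro mod_add_cong mod_diff_cong mod_mult_cong refl) simp_all

text \<open>The cubic is irreducible modulo 3, which makes the norm form anisotropic.\<close>

lemma three_dvd_cnorm:
  assumes "3 dvd cnorm a"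
  shows "of_int 3 dvd a"
proof -
  obtain x y z where a: "a = Cub x y z" by (cases a)
  have residues: "i mod 3 = 0 \<or> i mod 3 = 1 \<or> i mod 3 = 2" for i :: int by presburger
  have "cnorm (Cub (x mod 3) (y mod 3) (z mod 3)) mod 3 = 0"
    using assms cnorm_Cub_mod[of x y z 3] by (simp only: a mod_eq_0_iff_dvd[symmetric])
  then have "x mod 3 = 0 \<and> y mod 3 = 0 \<and> z mod 3 = 0"
    using residues[of x] residues[of y] residues[of z] by (elim disjE) simp_all
  then show ?thesis by (auto simp only: a of_int_dvd_Cub_iff mod_eq_0_iff_dvd)
qed

lemma cnorm_eq_0_iff [simp]: "cnorm a = 0 \<longleftrightarrow> a = 0"
proof
  show "a = 0" if "cnorm a = 0"
    using _ _ that
  proof (rule cubic_infinite_descent)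
    fix a
    assume "cnorm a = 0"
    then have "of_int 3 dvd a" by (intro three_dvd_cnorm) simp
    then obtain b where b: "a = of_int 3 * b" by (elim dvdE)
    with \<open>cnorm a = 0\<close> have "3 ^ 3 * cnorm b = 0" by (simp only: cnorm_mult cnorm_of_int)
    with b show "\<exists>b. a = of_int 3 * b \<and> cnorm b = 0" by auto
  qed simp
qed (simp add: zero_cubic_def)

instance cubic :: idom
proof
  fix a b :: cubic
  assume "a \<noteq> 0" "b \<noteq> 0"
  then have "cnorm a * cnorm b \<noteq> 0" by simp
  then show "a * b \<noteq> 0" by (simp only: cnorm_mult[symmetric] cnorm_eq_0_iff not_False_eq_True)
qed

instance cubic :: ring_char_0
proof
  have "int m = int n" if "(of_nat m :: cubic) = of_nat n" for m n
    using that by (metis cubic.inject of_int_cubic of_int_of_nat_eq)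
  then show "inj (of_nat :: nat \<Rightarrow> cubic)" by (intro injI) simp
qed

subsection \<open>Embeddings\<close>

definition cub_eval :: "'a::comm_ring_1 \<Rightarrow> cubic \<Rightarrow> 'a" where
  "cub_eval w a = of_int (coord0 a) + of_int (coord1 a) * w + of_int (coord2 a) * w\<^sup>2"

lemma cub_eval_mult:
  assumes root: "w ^ 3 + 5 * w = 2"
  shows "cub_eval w (a * b) = cub_eval w a * cub_eval w b"
proof -
  have "cub_eval w a * cub_eval w b = cub_eval w (a * b) + (w ^ 3 + 5 * w - 2)
      * (of_int (coord1 a * coord2 b + coord2 a * coord1 b) + of_int (coord2 a * coord2 b) * w)"
    by (simp add: cub_eval_def times_cubic_def algebra_simps power2_eq_square power3_eq_cube)
  then show ?thesis by (simp add: root)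
qed

lemma cnorm_eq_prod_cub_eval:
  fixes u v w :: "'a::comm_ring_1"
  assumes vieta: "u + v + w = 0" "u * v + u * w + v * w = 5" "u * v * w = 2"
  shows "cub_eval u a * (cub_eval v a * cub_eval w a) = of_int (cnorm a)"
proof (cases a)
  case (Cub x' y' z')
  define x y z :: 'a where "x = of_int x'" and "y = of_int y'" and "z = of_int z'"
  have sum: "v + w = - u"
    using vieta(1) by (simp add: eq_neg_iff_add_eq_0 algebra_simps)
  have "v * w = 5 - u * (v + w)"
    unfolding vieta(2)[symmetric] by (simp add: algebra_simps)
  then have prod: "v * w = 5 + u\<^sup>2" by (simp add: sum power2_eq_square)
  have "u * (v * w) = 2" using vieta(3) by (simp add: mult.assoc)
  then have root: "u ^ 3 + 5 * u - 2 = 0"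
    by (simp add: prod algebra_simps power2_eq_square power3_eq_cube)
  have pair: "cub_eval v a * cub_eval w a
      = x\<^sup>2 + x * y * (v + w) + x * z * ((v + w)\<^sup>2 - 2 * (v * w))
      + y\<^sup>2 * (v * w) + y * z * (v * w) * (v + w) + z\<^sup>2 * (v * w)\<^sup>2"
    by (simp add: Cub cub_eval_def algebra_simps power2_eq_square flip: x_def y_def z_def)
  have "cub_eval u a * (cub_eval v a * cub_eval w a) = of_int (cnorm a)
      + (u ^ 3 + 5 * u - 2) * (y ^ 3 - 3 * x * y * z + 5 * y * z\<^sup>2 + z ^ 3 * (u ^ 3 + 5 * u + 2))"
    unfolding pair sum prod
    by (simp add: Cub cub_eval_def algebra_simps power2_eq_square power3_eq_cube
        flip: x_def y_def z_def)
  then show ?thesis by (simp add: root)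
qed

definition real_theta :: real where
  "real_theta = (SOME t. t ^ 3 + 5 * t = 2)"

definition complex_theta :: complex where
  "complex_theta = Complex (- real_theta / 2) (sqrt (5 + 3 * real_theta\<^sup>2 / 4))"

abbreviation real_emb :: "cubic \<Rightarrow> real" where
  "real_emb \<equiv> cub_eval real_theta"

abbreviation complex_emb :: "cubic \<Rightarrow> complex" where
  "complex_emb \<equiv> cub_eval complex_theta"

lemma real_theta_root: "real_theta ^ 3 + 5 * real_theta = 2"
proof -
  have "\<exists>t\<ge>0. t \<le> 1 \<and> t ^ 3 + 5 * t = (2::real)"
    by (rule IVT') (auto intro!: continuous_intros)
  then show ?thesis unfolding real_theta_def by (metis (mono_tags, lifting) someI_ex)
qed

lemma real_theta_bounds: "97/250 < real_theta" "real_theta < 389/1000"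
proof -
  have "real_theta ^ 3 \<le> (97/250) ^ 3" if "real_theta \<le> 97/250"
    using that by (intro power_mono_odd) auto
  then show "97/250 < real_theta"
    using real_theta_root by (force simp: power3_eq_cube)
  have "(389/1000) ^ 3 \<le> real_theta ^ 3" if "389/1000 \<le> real_theta"
    using that by (intro power_mono) auto
  then show "real_theta < 389/1000"
    using real_theta_root by (force simp: power3_eq_cube)
qed

lemma Im_complex_theta_squared: "(Im complex_theta)\<^sup>2 = 5 + 3 * real_theta\<^sup>2 / 4"
  by (simp add: complex_theta_def add_nonneg_nonneg)

lemma complex_theta_conjugates:
  defines "t \<equiv> complex_of_real real_theta" and "w \<equiv> complex_theta"
  shows "t + w + cnj w = 0" "t * w + t * cnj w + w * cnj w = 5" "t * w * cnj w = 2"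
proof -
  have sum: "w + cnj w = - t"
    by (simp add: t_def w_def complex_theta_def complex_eq_iff)
  have "(Re w)\<^sup>2 + (Im w)\<^sup>2 = 5 + real_theta\<^sup>2"
    unfolding w_def Im_complex_theta_squared by (simp add: complex_theta_def power_divide)
  then have prod: "w * cnj w = 5 + t\<^sup>2"
    unfolding complex_mult_cnj t_def by (metis of_real_add of_real_numeral of_real_power)
  have t: "t ^ 3 + 5 * t = 2"
    using arg_cong[OF real_theta_root, of complex_of_real] by (simp add: t_def)
  show "t + w + cnj w = 0" using sum by algebra
  show "t * w + t * cnj w + w * cnj w = 5" using sum prod by algebra
  show "t * w * cnj w = 2"
    using t by (simp add: mult.assoc prod algebra_simps power2_eq_square power3_eq_cube)
qed

lemma complex_theta_root: "complex_theta ^ 3 + 5 * complex_theta = 2"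
  using complex_theta_conjugates by algebra

lemmas real_emb_mult = cub_eval_mult[OF real_theta_root]
lemmas complex_emb_mult = cub_eval_mult[OF complex_theta_root]

lemma cub_eval_cnj: "cub_eval (cnj w) a = cnj (cub_eval w a)"
  by (simp add: cub_eval_def)

lemma cub_eval_of_real: "cub_eval (of_real t) a = of_real (cub_eval t a)"
  by (simp add: cub_eval_def)

lemma cnorm_eq_embeddings: "real_emb a * (cmod (complex_emb a))\<^sup>2 = of_int (cnorm a)"
proof -
  have "complex_of_real (real_emb a * (cmod (complex_emb a))\<^sup>2)
      = cub_eval (of_real real_theta) a
        * (cub_eval complex_theta a * cub_eval (cnj complex_theta) a)"
    by (simp only: of_real_mult complex_norm_square cub_eval_cnj cub_eval_of_real)
  also have "\<dots> = of_int (cnorm a)"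
    by (rule cnorm_eq_prod_cub_eval[OF complex_theta_conjugates])
  finally show ?thesis by (metis of_real_eq_iff of_real_of_int_eq)
qed

lemma complex_emb_Cub:
  "Re (complex_emb (Cub x y z)) = x - y * real_theta / 2 - z * (5 + real_theta\<^sup>2 / 2)"
  "Im (complex_emb (Cub x y z)) = Im complex_theta * (y - z * real_theta)"
proof -
  have square: "complex_theta\<^sup>2
      = Complex (- 5 - real_theta\<^sup>2 / 2) (- Im complex_theta * real_theta)"
    using Im_complex_theta_squared
    by (simp add: complex_eq_iff power2_eq_square) (simp add: complex_theta_def field_simps)
  show "Re (complex_emb (Cub x y z)) = x - y * real_theta / 2 - z * (5 + real_theta\<^sup>2 / 2)"
    by (simp add: cub_eval_def square) (simp add: complex_theta_def field_simps)
  show "Im (complex_emb (Cub x y z)) = Im complex_theta * (y - z * real_theta)"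
    by (simp add: cub_eval_def square algebra_simps)
qed

section \<open>Small representatives of square classes\<close>

abbreviation (input) lin :: "int \<Rightarrow> int \<Rightarrow> cubic" where
  "lin m n \<equiv> Cub m (- n) 0"

lemma dvd_square_of_residue:
  fixes m n s \<tau> :: int
  assumes cop: "coprime n s" and \<tau>: "s dvd n * \<tau> - m"
    and \<alpha>: "\<alpha> dvd lin m n" "\<alpha> dvd of_int (s\<^sup>2)" and \<beta>: "s dvd cub_eval \<tau> \<beta>"
  shows "\<alpha> dvd \<beta>\<^sup>2"
proof -
  obtain x y z where xyz: "\<beta> = Cub x y z" by (cases \<beta>)
  define P where "P = Cub (- n * y - m * z) (- n * z) 0"
  have "n\<^sup>2 * x + n * m * y + m\<^sup>2 * z
      = n\<^sup>2 * cub_eval \<tau> \<beta> - (n * \<tau> - m) * (n * y + z * (n * \<tau> + m))"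
    unfolding xyz cub_eval_def by simp algebra
  also have "s dvd \<dots>" using \<tau> \<beta> by (intro dvd_diff) auto
  finally obtain Q where Q: "n\<^sup>2 * x + n * m * y + m\<^sup>2 * z = s * Q" by (elim dvdE)
  have remainder: "of_int (n\<^sup>2) * \<beta> = lin m n * P + of_int (s * Q)"
    unfolding Q[symmetric]
    by (simp add: xyz P_def of_int_cubic Cub_mult plus_cubic_def algebra_simps power2_eq_square)
  have "coprime (n\<^sup>2) s" using cop by simp
  then obtain u w where bezout: "u * n\<^sup>2 + w * s = 1"
    using bezout_int[of "n\<^sup>2" s] by (metis coprime_iff_gcd_eq_1)
  define P' Q' where "P' = of_int u * P" and "Q' = of_int (u * Q) + of_int w * \<beta>"
  have "\<beta> = of_int (u * n\<^sup>2 + w * s) * \<beta>" unfolding bezout by simp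
  also have "\<dots> = of_int u * (of_int (n\<^sup>2) * \<beta>) + of_int (w * s) * \<beta>"
    by (simp add: algebra_simps)
  also have "\<dots> = lin m n * P' + of_int s * Q'"
    unfolding remainder P'_def Q'_def by (simp add: algebra_simps)
  finally have "\<beta>\<^sup>2 = lin m n * (lin m n * P'\<^sup>2 + 2 * of_int s * P' * Q') + of_int (s\<^sup>2) * Q'\<^sup>2"
    by (simp add: algebra_simps power2_eq_square)
  then show ?thesis using \<alpha> by simp
qed

text \<open>152 is the squared covolume of $\mathbb{Z}[\theta]$ in $\mathbb{R}\times\mathbb{C}$.\<close>

lemma covolume_squared: "(Im complex_theta * (5 + 3 * real_theta\<^sup>2))\<^sup>2 = 152"
proof -
  let ?t = real_theta
  have "(Im complex_theta * (5 + 3 * ?t\<^sup>2))\<^sup>2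
      = 152 + (?t ^ 3 + 5 * ?t - 2) * (27 * ?t ^ 3 + 135 * ?t + 54) / 4"
    unfolding power_mult_distrib Im_complex_theta_squared
    by (simp add: field_simps power2_eq_square power3_eq_cube)
  then show ?thesis by (simp add: real_theta_root)
qed

text \<open>The matrix of the two embeddings, weighted by \<open>a\<close> and \<open>b\<close>, with respect to the
  basis $s$, $\theta-\tau$, $\theta^2-\tau^2$ of the lattice of elements that vanish at $\tau$
  modulo $s$.\<close>

definition lattice_matrix :: "int \<Rightarrow> int \<Rightarrow> real \<Rightarrow> real \<Rightarrow> real^3^3" where
  "lattice_matrix s \<tau> a b = (let t = real_theta; \<omega> = Im complex_theta in vector
    [vector [a * s, a * (t - \<tau>), a * (t\<^sup>2 - \<tau>\<^sup>2)],
     vector [b * s, b * (- t / 2 - \<tau>), b * (- 5 - t\<^sup>2 / 2 - \<tau>\<^sup>2)],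
     vector [0, b * \<omega>, - b * \<omega> * t]])"

lemma det_lattice_matrix_squared:
  "(det (lattice_matrix s \<tau> a b))\<^sup>2 = 152 * (a * b\<^sup>2 * s)\<^sup>2"
proof -
  have "det (lattice_matrix s \<tau> a b)
      = a * b\<^sup>2 * s * (Im complex_theta * (5 + 3 * real_theta\<^sup>2))"
    unfolding lattice_matrix_def Let_def det_3 by (simp add: field_simps power2_eq_square)
  then show ?thesis by (simp add: power_mult_distrib flip: covolume_squared)
qed

lemma norm_lattice_matrix_squared:
  fixes s \<tau> k y z :: int
  assumes v: "v $ 1 = k" "v $ 2 = y" "v $ 3 = z"
  defines "\<beta> \<equiv> Cub (s * k - \<tau> * y - \<tau>\<^sup>2 * z) y z"
  shows "(norm (lattice_matrix s \<tau> a b *v v))\<^sup>2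
    = (a * real_emb \<beta>)\<^sup>2 + (b * cmod (complex_emb \<beta>))\<^sup>2"
proof -
  let ?A = "lattice_matrix s \<tau> a b"
  have "(?A *v v) $ 1 = a * real_emb \<beta>" "(?A *v v) $ 2 = b * Re (complex_emb \<beta>)"
    "(?A *v v) $ 3 = b * Im (complex_emb \<beta>)"
    unfolding \<beta>_def complex_emb_Cub
    by (simp_all add: lattice_matrix_def Let_def matrix_vector_mult_def sum_3 v cub_eval_def
        algebra_simps)
  then show ?thesis
    by (simp add: norm_vec_def L2_set_def sum_3 cmod_power2 power_mult_distrib distrib_left)
qed

text \<open>The constant is $608=4\cdot 152$; the factor 4 is a bound for $(6/\pi)^2$.\<close>

lemma short_residue_element:
  fixes s \<tau> :: int and e q K :: real
  assumes "s \<noteq> 0" and pos: "e > 0" "q > 0" "K > 0" and large: "608 * s\<^sup>2 < K ^ 3 * e * q\<^sup>2"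
  obtains \<beta> where "\<beta> \<noteq> 0" "s dvd cub_eval \<tau> \<beta>"
    "(real_emb \<beta>)\<^sup>2 / e + (cmod (complex_emb \<beta>))\<^sup>2 / q \<le> K"
proof -
  define A where "A = lattice_matrix s \<tau> (1 / sqrt e) (1 / sqrt q)"
  have det_squared: "(det A)\<^sup>2 = 152 * s\<^sup>2 / (e * q\<^sup>2)"
    using pos by (simp add: A_def det_lattice_matrix_squared power_divide power_mult_distrib)
  then have det: "det A \<noteq> 0"
    using \<open>s \<noteq> 0\<close> pos by auto
  have "\<bar>det A\<bar>\<^sup>2 < K ^ 3 / 4"
    using large pos by (simp add: det_squared divide_simps algebra_simps)
  also have "\<dots> = (sqrt K ^ 3 / 2)\<^sup>2"
    unfolding power_divide real_sqrt_power[symmetric] real_sqrt_abs using pos by simp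
  finally have "\<bar>det A\<bar> < sqrt K ^ 3 / 2"
    by (rule power2_less_imp_less) (use pos in simp)
  also have "\<dots> < pi / 6 * sqrt K ^ 3"
    using pi_approx(1) pos by simp
  finally have "2 ^ CARD(3) * \<bar>det A\<bar> < unit_ball_vol (real CARD(3)) * sqrt K ^ CARD(3)"
    by (simp add: unit_ball_vol_3)
  then obtain v where v: "v \<in> int_lattice" "v \<noteq> 0" "norm (A *v v) \<le> sqrt K"
    using minkowski_ellipsoid[OF det, of "sqrt K"] pos by auto
  then obtain k y z where kyz: "v $ 1 = of_int k" "v $ 2 = of_int y" "v $ 3 = of_int z"
    unfolding int_lattice_def by (metis (mono_tags, lifting) Ints_cases mem_Collect_eq)
  define \<beta> where "\<beta> = Cub (s * k - \<tau> * y - \<tau>\<^sup>2 * z) y z"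
  have "\<beta> \<noteq> 0"
    using \<open>s \<noteq> 0\<close> v(2) kyz by (auto simp: \<beta>_def zero_cubic_def vec_eq_iff forall_3)
  moreover have "s dvd cub_eval \<tau> \<beta>"
    by (simp add: \<beta>_def cub_eval_def algebra_simps)
  moreover have "(real_emb \<beta>)\<^sup>2 / e + (cmod (complex_emb \<beta>))\<^sup>2 / q = (norm (A *v v))\<^sup>2"
    using pos by (simp add: A_def \<beta>_def norm_lattice_matrix_squared[OF kyz] power_mult_distrib
        power_divide)
  moreover have "(norm (A *v v))\<^sup>2 \<le> K"
    using v(3) pos by (simp add: sqrt_ge_absD)
  ultimately show thesis using that by simp
qed

lemma coprime_of_dvd_cnorm_lin:
  assumes "coprime m n" and s: "s dvd cnorm (lin m n)"
  shows "coprime n s"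
proof (rule coprimeI)
  fix d assume d: "d dvd n" "d dvd s"
  have "m ^ 3 = cnorm (lin m n) - n * (5 * m * n - 2 * n\<^sup>2)"
    by (simp add: algebra_simps power2_eq_square power3_eq_cube)
  also have "d dvd \<dots>" using d s by (intro dvd_diff) (auto intro: dvd_trans)
  finally have "d dvd m ^ 3" .
  moreover have "coprime (m ^ 3) n" using assms(1) by simp
  ultimately show "is_unit d" using d(1) coprime_common_divisor by blast
qed

lemma small_cofactor:
  fixes m n s :: int and C :: real
  assumes cop: "coprime m n" and \<alpha>: "\<alpha> dvd lin m n" "cnorm \<alpha> = s\<^sup>2" and "s \<noteq> 0"
    and C: "C > 0" "C ^ 3 > 608"
  obtains \<beta> \<gamma> where "\<beta> \<noteq> 0" "\<beta>\<^sup>2 = \<alpha> * \<gamma>" "real_emb \<gamma> + cmod (complex_emb \<gamma>) \<le> C"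
proof -
  define e q where "e = real_emb \<alpha>" and "q = cmod (complex_emb \<alpha>)"
  have eq: "e * q\<^sup>2 = s\<^sup>2"
    using cnorm_eq_embeddings[of \<alpha>] \<alpha>(2) by (simp add: e_def q_def)
  have "e * q\<^sup>2 > 0" using \<open>s \<noteq> 0\<close> by (simp add: eq)
  then have pos: "e > 0" "q > 0" by (auto simp: zero_less_mult_iff q_def)
  have "s dvd cnorm (lin m n)"
    using \<alpha> by (metis cnorm_mult dvdE dvd_mult2 dvd_triv_left power2_eq_square)
  then have coprime: "coprime n s" by (rule coprime_of_dvd_cnorm_lin[OF cop])
  then obtain r w where "r * n + w * s = 1"
    using bezout_int[of n s] by (metis coprime_iff_gcd_eq_1)
  then have "s dvd n * (r * m) - m"
    by (intro dvdI[of _ _ "- w * m"]) algebra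
  then obtain \<tau> where \<tau>: "s dvd n * \<tau> - m" by blast
  have "608 * s\<^sup>2 < C ^ 3 * e * q\<^sup>2"
    using C \<open>s \<noteq> 0\<close> by (simp add: eq mult.assoc)
  then obtain \<beta> where \<beta>: "\<beta> \<noteq> 0" "s dvd cub_eval \<tau> \<beta>"
    "(real_emb \<beta>)\<^sup>2 / e + (cmod (complex_emb \<beta>))\<^sup>2 / q \<le> C"
    using short_residue_element[OF \<open>s \<noteq> 0\<close> pos C(1)] by blast
  have "\<alpha> dvd of_int (s\<^sup>2)" using mult_cadj[of \<alpha>] \<alpha>(2) by (metis dvd_triv_left)
  then have "\<alpha> dvd \<beta>\<^sup>2" by (rule dvd_square_of_residue[OF coprime \<tau> \<alpha>(1) _ \<beta>(2)])
  then obtain \<gamma> where \<gamma>: "\<beta>\<^sup>2 = \<alpha> * \<gamma>" by (elim dvdE)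
  have "(real_emb \<beta>)\<^sup>2 = e * real_emb \<gamma>" "(complex_emb \<beta>)\<^sup>2 = complex_emb \<alpha> * complex_emb \<gamma>"
    using arg_cong[OF \<gamma>, of real_emb] arg_cong[OF \<gamma>, of complex_emb]
    by (simp_all add: e_def power2_eq_square real_emb_mult complex_emb_mult)
  moreover from this have "(cmod (complex_emb \<beta>))\<^sup>2 = q * cmod (complex_emb \<gamma>)"
    by (metis norm_mult norm_power q_def)
  ultimately have "real_emb \<gamma> + cmod (complex_emb \<gamma>) \<le> C"
    using \<beta>(3) pos by simp
  then show thesis using that \<beta>(1) \<gamma> by blast
qed

lemma square_of_square_mult:
  fixes h v w :: int
  assumes "h\<^sup>2 * v = w\<^sup>2" "h \<noteq> 0"
  obtains u where "v = u\<^sup>2"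
proof -
  have "h\<^sup>2 dvd w\<^sup>2" unfolding assms(1)[symmetric] by simp
  then obtain u where "w = h * u" by (auto elim: dvdE)
  then have "v = u\<^sup>2" using assms by (simp add: power_mult_distrib)
  then show thesis by (rule that)
qed

lemma cnorm_cofactor_square:
  assumes "cnorm \<alpha> = s\<^sup>2" "s \<noteq> 0" "\<beta> \<noteq> 0" and eq: "\<beta>\<^sup>2 = \<alpha> * \<gamma>"
  obtains k where "k > 0" "cnorm \<gamma> = k\<^sup>2"
proof -
  have norms: "s\<^sup>2 * cnorm \<gamma> = (cnorm \<beta>)\<^sup>2"
    using arg_cong[OF eq, of cnorm] assms(1) by (simp add: cnorm_mult cnorm_power)
  then obtain k where "cnorm \<gamma> = k\<^sup>2"
    using square_of_square_mult \<open>s \<noteq> 0\<close> by blast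
  moreover have "cnorm \<gamma> \<noteq> 0"
    using norms \<open>\<beta> \<noteq> 0\<close> by (metis cnorm_eq_0_iff mult_zero_right power_eq_0_iff)
  ultimately show thesis using that[of "\<bar>k\<bar>"] by simp
qed

lemma prod_square_le_sum_cubed:
  fixes r R :: real
  assumes "r \<ge> 0" "R \<ge> 0"
  shows "27 * (r * R\<^sup>2) \<le> 4 * (r + R) ^ 3"
proof -
  have "4 * (r + R) ^ 3 - 27 * (r * R\<^sup>2) = (R - 2 * r)\<^sup>2 * (4 * R + r)" by algebra
  also have "\<dots> \<ge> 0" using assms by simp
  finally show ?thesis by simp
qed

lemma complex_emb_Cub_bounds:
  fixes x y z :: int
  defines "U \<equiv> x - y * real_theta / 2 - z * (5 + real_theta\<^sup>2 / 2)" and "V \<equiv> y - z * real_theta"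
  shows "U\<^sup>2 + 5 * V\<^sup>2 \<le> (cmod (complex_emb (Cub x y z)))\<^sup>2"
    and "\<bar>U\<bar> \<le> cmod (complex_emb (Cub x y z))"
    and "\<bar>V\<bar> \<le> 9 / 20 * cmod (complex_emb (Cub x y z))"
proof -
  let ?R = "cmod (complex_emb (Cub x y z))"
  have "5 * V\<^sup>2 \<le> (5 + 3 * real_theta\<^sup>2 / 4) * V\<^sup>2" by (intro mult_right_mono) auto
  also have "U\<^sup>2 + \<dots> = ?R\<^sup>2"
    by (simp add: cmod_power2 complex_emb_Cub Im_complex_theta_squared power_mult_distrib
        U_def V_def)
  finally show squares: "U\<^sup>2 + 5 * V\<^sup>2 \<le> ?R\<^sup>2" by simp
  then have "U\<^sup>2 \<le> ?R\<^sup>2" using zero_le_power2[of V] by linarith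
  then show "\<bar>U\<bar> \<le> ?R" using abs_le_square_iff[of U ?R] by simp
  have "(9 / 20 * ?R)\<^sup>2 = 81 / 400 * ?R\<^sup>2" by (simp add: power_mult_distrib power_divide)
  then have "V\<^sup>2 \<le> (9 / 20 * ?R)\<^sup>2"
    using squares zero_le_power2[of U] zero_le_power2[of ?R] by linarith
  then show "\<bar>V\<bar> \<le> 9 / 20 * ?R" using abs_le_square_iff[of V "9 / 20 * ?R"] by simp
qed

lemma real_theta_sq_bounds: "150 / 1000 \<le> real_theta\<^sup>2" "real_theta\<^sup>2 \<le> 152 / 1000"
proof -
  have "(97 / 250)\<^sup>2 \<le> real_theta\<^sup>2" "real_theta\<^sup>2 \<le> (389 / 1000)\<^sup>2"
    using real_theta_bounds by (auto intro!: power_mono)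
  then show "150 / 1000 \<le> real_theta\<^sup>2" "real_theta\<^sup>2 \<le> 152 / 1000"
    by (simp_all add: power2_eq_square)
qed

text \<open>The bound comes from $(212/25)^3>608$.\<close>

lemma small_element_box:
  fixes x y z :: int
  defines "g \<equiv> Cub x y z"
  assumes pos: "real_emb g > 0" and small: "real_emb g + cmod (complex_emb g) \<le> 212 / 25"
  shows "\<bar>z\<bar> \<le> 1" "\<bar>y\<bar> \<le> 4" "-1 \<le> x" "x \<le> 10"
proof -
  let ?t = real_theta and ?r = "real_emb g" and ?R = "cmod (complex_emb g)"
  define U where "U = x - y * ?t / 2 - z * (5 + ?t\<^sup>2 / 2)"
  define V where "V = y - z * ?t"
  have U: "\<bar>U\<bar> \<le> ?R" and V: "\<bar>V\<bar> \<le> 9 / 20 * ?R"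
    unfolding U_def V_def g_def by (fact complex_emb_Cub_bounds)+
  have scaled: "\<bar>k * c\<bar> \<le> l * b" if "\<bar>k\<bar> \<le> l" "0 \<le> c" "c \<le> b" for k l c b :: real
    unfolding abs_mult using that by (intro mult_mono) auto
  note t = real_theta_bounds real_theta_sq_bounds
  have "z * (5 + 3 * ?t\<^sup>2) = ?r - U - 3 / 2 * (V * ?t)"
    by (simp add: g_def cub_eval_def U_def V_def field_simps power2_eq_square)
  moreover have "\<bar>V * ?t\<bar> \<le> (9 / 20 * ?R) * (389 / 1000)"
    using t by (intro scaled V) auto
  ultimately have "\<bar>z * (5 + 3 * ?t\<^sup>2)\<bar> < 2 * (545 / 100)"
    using U pos small by linarith
  also have "\<dots> \<le> 2 * (5 + 3 * ?t\<^sup>2)" using t by simp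
  finally have "\<bar>real_of_int z\<bar> * (5 + 3 * ?t\<^sup>2) < 2 * (5 + 3 * ?t\<^sup>2)" by (simp add: abs_mult)
  then have "\<bar>real_of_int z\<bar> < 2" by (rule mult_right_less_imp_less) simp
  then show z: "\<bar>z\<bar> \<le> 1" by linarith
  have "\<bar>z * ?t\<bar> \<le> 1 * (389 / 1000)" "\<bar>z * ?t\<^sup>2\<bar> \<le> 1 * (152 / 1000)"
    using z t by (intro scaled; simp; linarith)+
  moreover from this have "\<bar>real_of_int y\<bar> < 5"
    using V pos small unfolding V_def by linarith
  then show y: "\<bar>y\<bar> \<le> 4" by linarith
  moreover have "\<bar>y * ?t\<bar> \<le> 4 * (389 / 1000)"
    using y t by (intro scaled; simp; linarith)
  moreover have "x = ?r - y * ?t - z * ?t\<^sup>2" by (simp add: g_def cub_eval_def)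
  ultimately have "-2 < real_of_int x" "real_of_int x < 11"
    using pos small norm_ge_zero[of "complex_emb g"] by linarith+
  then show "-1 \<le> x" "x \<le> 10" by linarith+
qed

text \<open>This is the only element of the box that has a square norm up to 81 and is missing from the
  table below.\<close>

lemma exceptional_element_not_small:
  "212 / 25 < real_emb (Cub (- 1) 3 1) + cmod (complex_emb (Cub (- 1) 3 1))"
proof -
  let ?t = real_theta and ?R = "cmod (complex_emb (Cub (- 1) 3 1))"
  note t = real_theta_bounds real_theta_sq_bounds
  have "(658 / 100)\<^sup>2 \<le> (6 + 3 / 2 * ?t + ?t\<^sup>2 / 2)\<^sup>2"
    using t by (intro power_mono) auto
  moreover have "(261 / 100)\<^sup>2 \<le> (3 - ?t)\<^sup>2"
    using t by (intro power_mono) auto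
  moreover have "(- 1 - 3 * ?t / 2 - (5 + ?t\<^sup>2 / 2))\<^sup>2 = (6 + 3 / 2 * ?t + ?t\<^sup>2 / 2)\<^sup>2"
    by (simp add: power2_eq_square algebra_simps)
  ultimately have "(212 / 25)\<^sup>2 < ?R\<^sup>2"
    using complex_emb_Cub_bounds(1)[of "- 1" 3 1] by (simp add: power2_eq_square)
  then have "212 / 25 < ?R" by (rule power2_less_imp_less) simp
  then show ?thesis using t by (simp add: cub_eval_def)
qed

definition class_representatives :: "cubic set" where
  "class_representatives = {1, Cub 1 (-1) 0, Cub 0 1 1, Cub 4 1 1}"

text \<open>An entry $(\gamma,\kappa,\eta)$ certifies by $4\gamma\kappa=\eta^2$ that $\gamma$ and $\kappa$
  have the same square class.\<close>

definition class_table :: "(cubic \<times> cubic \<times> cubic) list" where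
  "class_table = [
   (Cub 2 (-3) (-1), Cub 4 1 1, Cub 4 (-2) 2),
   (Cub 1 (-2) (-1), Cub 1 0 0, Cub 0 1 1),
   (Cub (-1) 3 (-1), Cub 1 0 0, Cub 0 1 (-1)),
   (Cub 1 (-1) 0, Cub 1 (-1) 0, Cub 2 (-2) 0),
   (Cub 2 (-1) 0, Cub 1 0 0, Cub 2 1 1),
   (Cub 1 0 0, Cub 1 0 0, Cub 2 0 0),
   (Cub 4 0 0, Cub 1 0 0, Cub 4 0 0),
   (Cub 0 2 0, Cub 1 0 0, Cub 2 (-1) 1),
   (Cub 2 2 0, Cub 0 1 1, Cub 4 (-4) 0),
   (Cub 2 (-3) 1, Cub 1 (-1) 0, Cub 0 4 0),
   (Cub 1 (-2) 1, Cub 1 0 0, Cub 2 (-2) 0),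
   (Cub 6 (-1) 1, Cub 0 1 1, Cub 4 (-2) 2),
   (Cub 0 0 1, Cub 1 0 0, Cub 0 2 0),
   (Cub 3 0 1, Cub 1 (-1) 0, Cub 2 2 0),
   (Cub 5 0 1, Cub 1 0 0, Cub 4 1 1),
   (Cub 0 1 1, Cub 0 1 1, Cub 0 2 2),
   (Cub 3 1 1, Cub 1 0 0, Cub 4 (-1) 1),
   (Cub 4 1 1, Cub 4 1 1, Cub 8 2 2),
   (Cub 6 1 1, Cub 1 (-1) 0, Cub 4 0 0),
   (Cub 1 2 1, Cub 1 0 0, Cub 2 2 0)]"

lemma class_table_square_class:
  assumes "\<gamma> \<in> set (map fst class_table)"
  obtains \<kappa> \<eta> where "\<kappa> \<in> class_representatives" "\<eta> \<noteq> 0" "4 * \<gamma> * \<kappa> = \<eta>\<^sup>2"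
proof -
  have "list_all (\<lambda>(\<gamma>, \<kappa>, \<eta>). \<kappa> \<in> class_representatives \<and> \<eta> \<noteq> 0 \<and> 4 * \<gamma> * \<kappa> = \<eta>\<^sup>2)
    class_table"
    unfolding class_table_def list.pred_inject prod.case
    by (intro conjI TrueI; simp add: class_representatives_def zero_cubic_def one_cubic_def
        numeral_cubic Cub_mult power2_eq_square)
  then show thesis using assms that by (fastforce simp: list_all_iff)
qed

lemma small_square_norm_in_table:
  assumes "z \<in> {-1..1}" "y \<in> {-4..4}" "x \<in> {-1..10}"
    and "cnorm (Cub x y z) \<in> {1, 4, 9, 16, 25, 36, 49, 64, 81}"
  shows "Cub x y z \<in> insert (Cub (- 1) 3 1) (set (map fst class_table))"
proof -
  have intervals: "[-1..1::int] = [-1, 0, 1]" "[-4..4::int] = [-4, -3, -2, -1, 0, 1, 2, 3, 4]"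
    "[-1..10::int] = [-1, 0, 1, 2, 3, 4, 5, 6, 7, 8, 9, 10]"
    by (simp_all add: upto_rec1)
  have "list_all (\<lambda>z. list_all (\<lambda>y. list_all (\<lambda>x.
      if cnorm (Cub x y z) \<in> {1, 4, 9, 16, 25, 36, 49, 64, 81}
      then Cub x y z \<in> insert (Cub (- 1) 3 1) (set (map fst class_table)) else True)
      [-1..10]) [-4..4]) [-1..1]"
    unfolding intervals list.pred_inject
    by (intro conjI TrueI; simp add: class_table_def)
  then show ?thesis
    using assms unfolding list_all_iff set_upto by presburger
qed

lemma small_element_square_class:
  assumes small: "real_emb \<gamma> + cmod (complex_emb \<gamma>) \<le> 212 / 25"
    and k: "k > 0" "cnorm \<gamma> = k\<^sup>2"
  obtains \<kappa> \<eta> where "\<kappa> \<in> class_representatives" "\<eta> \<noteq> 0" "4 * \<gamma> * \<kappa> = \<eta>\<^sup>2"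
proof -
  obtain x y z where \<gamma>: "\<gamma> = Cub x y z" by (cases \<gamma>)
  let ?r = "real_emb \<gamma>" and ?R = "cmod (complex_emb \<gamma>)"
  have norm: "?r * ?R\<^sup>2 = (real_of_int k)\<^sup>2"
    using cnorm_eq_embeddings[of \<gamma>] k(2) by simp
  then have "?r * ?R\<^sup>2 > 0" using k(1) by simp
  then have "?r > 0" by (auto simp: zero_less_mult_iff)
  have box: "z \<in> {-1..1}" "y \<in> {-4..4}" "x \<in> {-1..10}"
    using small_element_box[of x y z] \<open>?r > 0\<close> small unfolding \<gamma> by auto
  have "27 * (real_of_int k)\<^sup>2 \<le> 4 * (?r + ?R) ^ 3"
    using prod_square_le_sum_cubed[of ?r ?R] \<open>?r > 0\<close> by (simp add: norm)
  also have "\<dots> \<le> 4 * (212 / 25) ^ 3"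
    using small \<open>?r > 0\<close> by (intro mult_left_mono power_mono) auto
  finally have "(real_of_int k)\<^sup>2 < 10\<^sup>2" by (simp add: power3_eq_cube)
  then have "real_of_int k < 10" by (rule power2_less_imp_less) simp
  then have "k \<in> set [1..9]" using k(1) by auto
  then have "cnorm \<gamma> \<in> {1, 4, 9, 16, 25, 36, 49, 64, 81}"
    unfolding k(2) by (auto simp: upto_rec1 simp del: set_upto)
  then have "\<gamma> \<in> insert (Cub (- 1) 3 1) (set (map fst class_table))"
    unfolding \<gamma> by (rule small_square_norm_in_table[OF box])
  moreover have "\<gamma> \<noteq> Cub (- 1) 3 1" using exceptional_element_not_small small by auto
  ultimately show thesis using class_table_square_class that by auto
qed

section \<open>Two-coverings\<close>

text \<open>The curve is $v^2=(u-2)N(u-\theta)$. A point with $u=m/n$ and $m-n\theta=\kappa b^2$ gives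
  $\kappa b^2$ without $\theta^2$-term whose value at $\theta=2$ is a square.\<close>

definition two_covering :: "cubic \<Rightarrow> cubic \<Rightarrow> bool" where
  "two_covering \<kappa> b \<longleftrightarrow> (let a = \<kappa> * b\<^sup>2 in coord2 a = 0 \<and> (\<exists>d. coord0 a + 2 * coord1 a = d\<^sup>2))"

definition two_covering_mod_16 :: "cubic \<Rightarrow> cubic \<Rightarrow> bool" where
  "two_covering_mod_16 \<kappa> b \<longleftrightarrow> (let a = \<kappa> * b\<^sup>2 in
     coord2 a mod 16 = 0 \<and> (coord0 a + 2 * coord1 a) mod 16 \<in> {0, 1, 4, 9})"

lemma square_mod_image: "p > 0 \<Longrightarrow> (d::int)\<^sup>2 mod p \<in> (\<lambda>k. k * k mod p) ` {0..p - 1}"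
  by (intro image_eqI[of _ _ "d mod p"]) (auto simp: power2_eq_square mod_mult_eq)

lemma square_mod_16: "(d::int)\<^sup>2 mod 16 \<in> {0, 1, 4, 9}"
  using square_mod_image[of 16 d] unfolding set_upto[symmetric]
  by (simp add: upto_rec1 del: set_upto) blast

lemma two_covering_imp_mod_16: "two_covering \<kappa> b \<Longrightarrow> two_covering_mod_16 \<kappa> b"
  unfolding two_covering_def two_covering_mod_16_def Let_def by (metis mod_0 square_mod_16)

lemma two_covering_of_int_mult_iff:
  assumes "j \<noteq> 0"
  shows "two_covering \<kappa> (of_int j * b) \<longleftrightarrow> two_covering \<kappa> b"
proof -
  define a v where "a = \<kappa> * b\<^sup>2" and "v = coord0 a + 2 * coord1 a"
  have "\<kappa> * (of_int j * b)\<^sup>2 = of_int (j\<^sup>2) * a"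
    by (simp add: a_def power_mult_distrib algebra_simps)
  then have "two_covering \<kappa> (of_int j * b) \<longleftrightarrow> j\<^sup>2 * coord2 a = 0 \<and> (\<exists>d. j\<^sup>2 * v = d\<^sup>2)"
    by (simp only: two_covering_def Let_def coord_of_int_mult v_def distrib_left mult.left_commute)
  also have "(\<exists>d. j\<^sup>2 * v = d\<^sup>2) \<longleftrightarrow> (\<exists>d. v = d\<^sup>2)"
    using assms by (metis power_mult_distrib square_of_square_mult)
  also have "j\<^sup>2 * coord2 a = 0 \<longleftrightarrow> coord2 a = 0"
    using assms by simp
  finally show ?thesis
    by (simp only: two_covering_def Let_def a_def v_def)
qed

lemma two_covering_mod_16_cong:
  "two_covering_mod_16 \<kappa> (b + of_int 16 * w) \<longleftrightarrow> two_covering_mod_16 \<kappa> b"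
proof -
  define v where "v = \<kappa> * (2 * b * w + of_int 16 * w\<^sup>2)"
  have "\<kappa> * (b + of_int 16 * w)\<^sup>2 = \<kappa> * b\<^sup>2 + of_int 16 * v"
    unfolding v_def by (simp add: algebra_simps power2_eq_square)
  then have "coord0 (\<kappa> * (b + of_int 16 * w)\<^sup>2) + 2 * coord1 (\<kappa> * (b + of_int 16 * w)\<^sup>2)
      = coord0 (\<kappa> * b\<^sup>2) + 2 * coord1 (\<kappa> * b\<^sup>2) + 16 * (coord0 v + 2 * coord1 v)"
    and "coord2 (\<kappa> * (b + of_int 16 * w)\<^sup>2) = coord2 (\<kappa> * b\<^sup>2) + 16 * coord2 v"
    by (simp_all only: plus_cubic_def cubic.sel coord_of_int_mult distrib_left mult.left_commute
        add.assoc add.left_commute)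
  then show ?thesis
    unfolding two_covering_mod_16_def Let_def by (simp only: mod_mult_self2)
qed

lemma two_covering_mod_16_residues:
  "two_covering_mod_16 \<kappa> (Cub x y z)
    \<longleftrightarrow> two_covering_mod_16 \<kappa> (Cub (x mod 16) (y mod 16) (z mod 16))"
proof -
  have "Cub x y z = Cub (x mod 16) (y mod 16) (z mod 16)
      + of_int 16 * Cub (x div 16) (y div 16) (z div 16)"
    by (simp add: of_int_cubic Cub_mult plus_cubic_def)
  then show ?thesis by (metis two_covering_mod_16_cong)
qed

text \<open>Scaling by the inverse modulo 16 of an odd coordinate makes that coordinate 1.\<close>

definition locally_insoluble :: "cubic \<Rightarrow> bool" where
  "locally_insoluble \<kappa> \<longleftrightarrow> (\<forall>u\<in>set [0..15]. \<forall>v\<in>set [0..15].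
     \<not> two_covering_mod_16 \<kappa> (Cub 1 u v) \<and> \<not> two_covering_mod_16 \<kappa> (Cub u 1 v)
     \<and> \<not> two_covering_mod_16 \<kappa> (Cub u v 1))"

lemma two_covering_even:
  assumes \<kappa>: "locally_insoluble \<kappa>" and b: "two_covering \<kappa> (Cub x y z)"
  shows "even x \<and> even y \<and> even z"
proof -
  have residue: "k mod 16 \<in> set [0..15]" for k :: int by simp
  have scaled: "two_covering_mod_16 \<kappa> (Cub (j * x mod 16) (j * y mod 16) (j * z mod 16))"
    if "j \<noteq> 0" for j
    using two_covering_imp_mod_16[of \<kappa> "of_int j * Cub x y z"] b that
    by (simp add: two_covering_of_int_mult_iff)
      (simp add: of_int_cubic Cub_mult flip: two_covering_mod_16_residues)
  have inverse: "\<exists>j. j \<noteq> 0 \<and> j * k mod 16 = 1" if "odd k" for k :: int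
  proof -
    have "coprime k (2 ^ 4)"
      using that by (metis coprime_power_right_iff coprime_right_2_iff_odd)
    then obtain j w where "j * k + w * 2 ^ 4 = 1"
      using bezout_int[of k "2 ^ 4"] by (metis coprime_iff_gcd_eq_1)
    then have "j * k + w * 16 = 1" by simp
    then have "j * k mod 16 = 1" by presburger
    moreover from this have "j \<noteq> 0" by auto
    ultimately show ?thesis by blast
  qed
  show ?thesis
    using inverse[of x] inverse[of y] inverse[of z] scaled \<kappa> residue
    unfolding locally_insoluble_def by metis
qed

lemma two_covering_trivial:
  assumes "locally_insoluble \<kappa>" "two_covering \<kappa> b"
  shows "b = 0"
  using _ _ \<open>two_covering \<kappa> b\<close>
proof (rule cubic_infinite_descent)
  fix b
  assume b: "two_covering \<kappa> b"
  obtain x y z where xyz: "b = Cub x y z" by (cases b)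
  then have "even x \<and> even y \<and> even z"
    using two_covering_even assms(1) b by simp
  then have "of_int 2 dvd b" unfolding xyz of_int_dvd_Cub_iff .
  then obtain b' where "b = of_int 2 * b'" by (elim dvdE)
  moreover from this have "two_covering \<kappa> b'"
    using b two_covering_of_int_mult_iff[of 2] by simp
  ultimately show "\<exists>b'. b = of_int 2 * b' \<and> two_covering \<kappa> b'" by blast
qed simp

text \<open>The conditional makes the simplifier evaluate the second form only where the first one
  vanishes.\<close>

lemma two_covering_mod_16_Cub:
  "two_covering_mod_16 (Cub a b c) (Cub x y z) \<longleftrightarrow>
    (if (a * (y * y + 2 * x * z - 5 * z * z) + b * (2 * x * y - 10 * y * z + 2 * z * z)
       + c * (x * x + 4 * y * z) - 5 * (c * (y * y + 2 * x * z - 5 * z * z))) mod 16 = 0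
     then (coord0 (Cub a b c * (Cub x y z)\<^sup>2) + 2 * coord1 (Cub a b c * (Cub x y z)\<^sup>2)) mod 16
       \<in> {0, 1, 4, 9}
     else False)"
  by (simp add: two_covering_mod_16_def Cub_mult power2_eq_square algebra_simps)

lemma class_representatives_locally_insoluble:
  "locally_insoluble (Cub 1 (-1) 0)" "locally_insoluble (Cub 0 1 1)"
  "locally_insoluble (Cub 4 1 1)"
proof -
  have residues: "[0..15::int] = [0, 1, 2, 3, 4, 5, 6, 7, 8, 9, 10, 11, 12, 13, 14, 15]"
    by (simp add: upto_rec1)
  show "locally_insoluble (Cub 1 (-1) 0)" "locally_insoluble (Cub 0 1 1)"
    "locally_insoluble (Cub 4 1 1)"
    unfolding locally_insoluble_def list_all_iff[symmetric] residues list.pred_inject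
    by (intro conjI TrueI; simp add: two_covering_mod_16_Cub Cub_mult power2_eq_square)+
qed

section \<open>The two-descent\<close>

text \<open>For $c=2$ the element $m-n\theta$ is divisible by $\theta$, whose norm is 2 and which is a
  square up to the factor 2.\<close>

lemma lin_square_norm_divisor:
  fixes m n s c \<delta> :: int
  assumes c: "c = 1 \<or> c = 2" and s: "cnorm (lin m n) = c * s\<^sup>2" and \<delta>: "m - 2 * n = c * \<delta>\<^sup>2"
  obtains \<alpha> \<rho> where "\<alpha> dvd lin m n" "cnorm \<alpha> = s\<^sup>2" "of_int (4 * c) * lin m n = \<rho>\<^sup>2 * \<alpha>"
  using c
proof
  assume "c = 1"
  then show thesis
    using that[of "lin m n" 2] s by simp
next
  assume "c = 2"
  define j where "j = \<delta>\<^sup>2 + n"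
  have m: "m = 2 * j" using \<delta> \<open>c = 2\<close> by (simp add: j_def)
  define \<alpha> where "\<alpha> = Cub (5 * j - n) 0 j"
  have \<alpha>: "lin m n = Cub 0 1 0 * \<alpha>" by (simp add: \<alpha>_def m Cub_mult)
  then have "cnorm \<alpha> = s\<^sup>2" using s \<open>c = 2\<close> by (simp only: \<alpha> cnorm_mult) simp
  moreover have "of_int (4 * c) * lin m n = (Cub 2 (-1) 1)\<^sup>2 * \<alpha>"
    unfolding \<alpha> mult.assoc[symmetric]
    by (simp add: \<open>c = 2\<close> numeral_cubic Cub_mult power2_eq_square)
  ultimately show thesis
    using that[of \<alpha> "Cub 2 (-1) 1"] \<alpha> by simp
qed

lemma square_class_of_lin:
  fixes m n s c \<delta> :: int
  assumes cop: "coprime m n" and c: "c = 1 \<or> c = 2"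
    and s: "cnorm (lin m n) = c * s\<^sup>2" and \<delta>: "m - 2 * n = c * \<delta>\<^sup>2"
  obtains \<kappa> b l where "\<kappa> \<in> class_representatives" "l \<noteq> 0" "\<kappa> * b\<^sup>2 = of_int (l\<^sup>2 * c) * lin m n"
proof -
  obtain \<alpha> \<rho> where \<alpha>: "\<alpha> dvd lin m n" "cnorm \<alpha> = s\<^sup>2"
    and \<rho>: "of_int (4 * c) * lin m n = \<rho>\<^sup>2 * \<alpha>"
    using lin_square_norm_divisor[OF c s \<delta>] .
  have "lin m n \<noteq> 0" using cop by (auto simp: zero_cubic_def)
  then have "cnorm \<alpha> \<noteq> 0" using \<alpha>(1) by auto
  then have "s \<noteq> 0" using \<alpha>(2) by auto
  obtain \<beta> \<gamma> where \<beta>: "\<beta> \<noteq> 0" "\<beta>\<^sup>2 = \<alpha> * \<gamma>"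
    and small: "real_emb \<gamma> + cmod (complex_emb \<gamma>) \<le> 212 / 25"
    using small_cofactor[OF cop \<alpha> \<open>s \<noteq> 0\<close>, of "212 / 25"] by (auto simp: power3_eq_cube)
  obtain k where "k > 0" "cnorm \<gamma> = k\<^sup>2"
    using cnorm_cofactor_square[OF \<alpha>(2) \<open>s \<noteq> 0\<close> \<beta>] .
  then obtain \<kappa> \<eta> where \<kappa>: "\<kappa> \<in> class_representatives" and \<eta>: "\<eta> \<noteq> 0" "4 * \<gamma> * \<kappa> = \<eta>\<^sup>2"
    using small_element_square_class[OF small] by blast
  define l b where "l = 2 * cnorm \<eta>" and "b = 2 * \<beta> * \<rho> * cadj \<eta>"
  have "\<kappa> * b\<^sup>2 = (4 * \<gamma> * \<kappa>) * (\<rho>\<^sup>2 * \<alpha>) * (cadj \<eta>)\<^sup>2"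
    by (simp add: b_def power_mult_distrib \<beta>(2) algebra_simps)
  also have "\<dots> = (\<eta> * cadj \<eta>)\<^sup>2 * (of_int (4 * c) * lin m n)"
    unfolding \<eta>(2) \<rho>[symmetric] by (simp add: power_mult_distrib algebra_simps)
  also have "\<dots> = of_int (l\<^sup>2 * c) * lin m n"
    unfolding mult_cadj by (simp add: l_def power_mult_distrib algebra_simps)
  finally have "\<kappa> * b\<^sup>2 = of_int (l\<^sup>2 * c) * lin m n" .
  moreover have "l \<noteq> 0" using \<eta>(1) by (simp add: l_def)
  ultimately show thesis using that \<kappa> by blast
qed

lemma lin_multiple_square:
  fixes m n s c \<delta> :: int
  assumes cop: "coprime m n" and c: "c = 1 \<or> c = 2"
    and s: "cnorm (lin m n) = c * s\<^sup>2" and \<delta>: "m - 2 * n = c * \<delta>\<^sup>2"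
  obtains b L e where "L \<noteq> 0" "b\<^sup>2 = lin (L * m) (L * n)" "L * m - 2 * (L * n) = e\<^sup>2"
proof -
  obtain \<kappa> b l where \<kappa>: "\<kappa> \<in> class_representatives" and l: "l \<noteq> 0"
    and b: "\<kappa> * b\<^sup>2 = of_int (l\<^sup>2 * c) * lin m n"
    using square_class_of_lin[OF assms] .
  define L where "L = l\<^sup>2 * c"
  have "L \<noteq> 0" using l c by (auto simp: L_def)
  have square: "\<kappa> * b\<^sup>2 = lin (L * m) (L * n)"
    unfolding b L_def by (simp only: of_int_cubic Cub_mult) simp
  have "lin (L * m) (L * n) \<noteq> 0" using \<open>L \<noteq> 0\<close> cop by (auto simp: zero_cubic_def)
  then have "b \<noteq> 0" unfolding square[symmetric] by auto
  have e: "L * m - 2 * (L * n) = (l * c * \<delta>)\<^sup>2"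
    using arg_cong[OF \<delta>, of "\<lambda>i. L * i"] by (simp add: L_def power2_eq_square algebra_simps)
  then have "two_covering \<kappa> b"
    unfolding two_covering_def Let_def square by auto
  then have "\<not> locally_insoluble \<kappa>" using two_covering_trivial \<open>b \<noteq> 0\<close> by blast
  then have "\<kappa> = 1"
    using \<kappa> class_representatives_locally_insoluble by (auto simp: class_representatives_def)
  then show thesis using that \<open>L \<noteq> 0\<close> square e by simp
qed

section \<open>Halving\<close>

definition curve :: "int \<Rightarrow> int \<Rightarrow> int" where
  "curve m n = (m - 2 * n) * (m ^ 3 + 5 * m * n\<^sup>2 - 2 * n ^ 3)"

text \<open>If $P$ has abscissa $X/Y$, then $2P$ has abscissa \<open>double_num X Y / double_den X Y\<close>.\<close>

definition double_num :: "int \<Rightarrow> int \<Rightarrow> int" where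
  "double_num X Y = 2 * Y * (4 * Y ^ 3 - 4 * X * Y\<^sup>2 - X\<^sup>2 * Y + 2 * X ^ 3)"

definition double_den :: "int \<Rightarrow> int \<Rightarrow> int" where
  "double_den X Y = X * (8 * Y ^ 3 - 6 * X * Y\<^sup>2 + 4 * X\<^sup>2 * Y - X ^ 3)"

lemma quartic_forms_scale:
  "curve (h * X) (h * Y) = (h\<^sup>2)\<^sup>2 * curve X Y"
  "double_num (h * X) (h * Y) = (h\<^sup>2)\<^sup>2 * double_num X Y"
  "double_den (h * X) (h * Y) = (h\<^sup>2)\<^sup>2 * double_den X Y"
  unfolding curve_def double_num_def double_den_def by algebra+

text \<open>The vanishing $\theta^2$-coefficient of $b^2$ is a conic with the parametrisation
  $b_1/b_2=4Y/X-1$; in these coordinates the remaining condition is the original curve.\<close>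

lemma square_root_coordinates:
  fixes b0 b1 b2 M N e :: int
  assumes square: "(Cub b0 b1 b2)\<^sup>2 = lin M N" and e: "M - 2 * N = e\<^sup>2"
  shows "double_num (4 * b2) (b1 + b2) = 32 * b2\<^sup>2 * M"
    "double_den (4 * b2) (b1 + b2) = 32 * b2\<^sup>2 * N"
    "curve (4 * b2) (b1 + b2) = (4 * b2 * e)\<^sup>2"
proof -
  have M: "M = b0 * b0 + 4 * b1 * b2" and N: "N = - (2 * b0 * b1 - 10 * b1 * b2 + 2 * b2 * b2)"
    and conic: "b1 * b1 + 2 * b0 * b2 - 5 * b2 * b2 = 0"
    using square by (simp_all add: power2_eq_square Cub_mult algebra_simps)
  show "double_num (4 * b2) (b1 + b2) = 32 * b2\<^sup>2 * M"
    unfolding double_num_def M using conic by algebra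
  show "double_den (4 * b2) (b1 + b2) = 32 * b2\<^sup>2 * N"
    unfolding double_den_def N using conic by algebra
  show "curve (4 * b2) (b1 + b2) = (4 * b2 * e)\<^sup>2"
    unfolding curve_def power_mult_distrib e[symmetric] M N using conic by algebra
qed

lemma coprime_proportional:
  fixes m n P Q :: int
  assumes "coprime m n" "n \<noteq> 0" "P * n = Q * m"
  obtains g where "P = g * m" "Q = g * n"
proof -
  have "n dvd Q * m" using assms(3) by (metis dvd_triv_right)
  then have "n dvd Q" using assms(1) by (simp add: coprime_commute coprime_dvd_mult_left_iff)
  then obtain g where "Q = g * n" by (metis dvdE mult.commute)
  moreover from this have "P = g * m" using assms(2,3) by simp
  ultimately show thesis using that by blast
qed

lemma halving:
  fixes m n L e :: int
  assumes cop: "coprime m n" and n: "n \<noteq> 0" and L: "L \<noteq> 0"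
    and square: "b\<^sup>2 = lin (L * m) (L * n)" and e: "L * m - 2 * (L * n) = e\<^sup>2"
  obtains X Y g W where "coprime X Y" "curve X Y = W\<^sup>2" "g \<noteq> 0"
    "double_num X Y = g * m" "double_den X Y = g * n"
proof -
  obtain b0 b1 b2 where b: "b = Cub b0 b1 b2" by (cases b)
  have "b2 \<noteq> 0"
  proof
    assume "b2 = 0"
    then have "L * n = 0" using square by (auto simp: b power2_eq_square Cub_mult)
    then show False using L n by simp
  qed
  define h where "h = gcd (4 * b2) (b1 + b2)"
  have "h \<noteq> 0" using \<open>b2 \<noteq> 0\<close> by (simp add: h_def)
  then obtain X Y where XY: "4 * b2 = h * X" "b1 + b2 = h * Y" "coprime X Y"
    using gcd_coprime_exists[of "4 * b2" "b1 + b2"] unfolding h_def by (metis mult.commute)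
  have num: "(h\<^sup>2)\<^sup>2 * double_num X Y = 32 * b2\<^sup>2 * (L * m)"
    and den: "(h\<^sup>2)\<^sup>2 * double_den X Y = 32 * b2\<^sup>2 * (L * n)"
    and "(h\<^sup>2)\<^sup>2 * curve X Y = (4 * b2 * e)\<^sup>2"
    using square_root_coordinates[OF square[unfolded b] e]
    by (simp_all only: XY quartic_forms_scale)
  then obtain W where "curve X Y = W\<^sup>2"
    using square_of_square_mult \<open>h \<noteq> 0\<close> by (metis power_eq_0_iff)
  moreover have "(h\<^sup>2)\<^sup>2 * (double_num X Y * n) = (h\<^sup>2)\<^sup>2 * (double_den X Y * m)"
    unfolding mult.assoc[symmetric] num den by simp
  then have "double_num X Y * n = double_den X Y * m" using \<open>h \<noteq> 0\<close> by simp
  then obtain g where g: "double_num X Y = g * m" "double_den X Y = g * n"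
    by (rule coprime_proportional[OF cop n])
  moreover have "g \<noteq> 0"
    using den g(2) L \<open>b2 \<noteq> 0\<close> n by auto
  ultimately show thesis using that XY(3) by blast
qed

section \<open>Heights\<close>

lemma double_resultant:
  "304 * Y ^ 7 = (38 * Y ^ 3 - 28 * X * Y\<^sup>2 + 23 * X\<^sup>2 * Y - 6 * X ^ 3) * double_num X Y
    + (66 * Y ^ 3 + 8 * X * Y\<^sup>2 - 24 * X\<^sup>2 * Y) * double_den X Y"
  "19 * X ^ 7 = (48 * X * Y\<^sup>2 - 24 * X\<^sup>2 * Y + 23 * X ^ 3) * double_num X Y
    + (36 * X * Y\<^sup>2 - 48 * Y ^ 3 + 16 * X\<^sup>2 * Y - 19 * X ^ 3) * double_den X Y"
  unfolding double_num_def double_den_def by algebra+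

lemma common_divisor_double:
  assumes "coprime X Y" "g dvd double_num X Y" "g dvd double_den X Y"
  shows "g dvd 304"
proof -
  have "g dvd 304 * Y ^ 7" and "g dvd 19 * X ^ 7"
    unfolding double_resultant(1)[of Y X] double_resultant(2)[of X Y]
    using assms(2,3) by (auto intro: dvd_add dvd_mult)
  then have "g dvd gcd (304 * X ^ 7) (304 * Y ^ 7)"
    using dvd_mult[of g "19 * X ^ 7" 16] by simp
  also have "\<dots> = 304"
    using assms(1) by (simp add: gcd_mult_left coprime_imp_gcd_eq_1)
  finally show ?thesis .
qed

lemma abs_cubic_monomials_le:
  fixes X Y H :: "'a::linordered_idom"
  assumes H: "\<bar>X\<bar> \<le> H" "\<bar>Y\<bar> \<le> H"
  shows "\<bar>X ^ 3\<bar> \<le> H ^ 3" "\<bar>X\<^sup>2 * Y\<bar> \<le> H ^ 3" "\<bar>X * Y\<^sup>2\<bar> \<le> H ^ 3" "\<bar>Y ^ 3\<bar> \<le> H ^ 3"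
proof -
  have "H \<ge> 0" using H(1) abs_ge_zero order_trans by blast
  then have "\<bar>u * v * w\<bar> \<le> H * H * H" if "\<bar>u\<bar> \<le> H" "\<bar>v\<bar> \<le> H" "\<bar>w\<bar> \<le> H" for u v w
    unfolding abs_mult using that by (intro mult_mono) auto
  from this[of X X X] this[of X X Y] this[of X Y Y] this[of Y Y Y] H
  show "\<bar>X ^ 3\<bar> \<le> H ^ 3" "\<bar>X\<^sup>2 * Y\<bar> \<le> H ^ 3" "\<bar>X * Y\<^sup>2\<bar> \<le> H ^ 3" "\<bar>Y ^ 3\<bar> \<le> H ^ 3"
    by (simp_all add: power2_eq_square power3_eq_cube mult.assoc)
qed

lemma abs_lin_comb_le:
  fixes P Q m n :: "'a::linordered_idom"
  assumes "\<bar>P\<bar> \<le> p" "\<bar>Q\<bar> \<le> q" "\<bar>m\<bar> \<le> M" "\<bar>n\<bar> \<le> M"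
  shows "\<bar>P * m + Q * n\<bar> \<le> (p + q) * M"
proof -
  have "p \<ge> 0" "q \<ge> 0" using assms(1,2) abs_ge_zero order_trans by blast+
  then have "\<bar>P * m\<bar> \<le> p * M" "\<bar>Q * n\<bar> \<le> q * M"
    unfolding abs_mult using assms by (auto intro!: mult_mono)
  then show ?thesis using abs_triangle_ineq[of "P * m" "Q * n"] by (simp add: algebra_simps)
qed

text \<open>The constant is $304\cdot(95+119)/19$, from the coefficient sums in \<open>double_resultant\<close>.\<close>

lemma double_height:
  fixes X Y g m n :: int
  assumes cop: "coprime X Y"
    and num: "double_num X Y = g * m" and den: "double_den X Y = g * n"
  shows "max \<bar>X\<bar> \<bar>Y\<bar> ^ 4 \<le> 3424 * max \<bar>m\<bar> \<bar>n\<bar>"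
proof -
  define H M where "H = max \<bar>X\<bar> \<bar>Y\<bar>" and "M = max \<bar>m\<bar> \<bar>n\<bar>"
  have "g dvd 304" using common_divisor_double[OF cop, of g] num den by simp
  then have g: "\<bar>g\<bar> \<le> 304" using zdvd_imp_le[of "\<bar>g\<bar>" 304] by simp
  have "\<bar>X\<bar> \<le> H" "\<bar>Y\<bar> \<le> H" by (simp_all add: H_def)
  note monomials = abs_cubic_monomials_le[OF this]
  have bound: "\<bar>g * (P * m + Q * n)\<bar> \<le> 304 * ((p * H ^ 3 + q * H ^ 3) * M)"
    if "\<bar>P\<bar> \<le> p * H ^ 3" "\<bar>Q\<bar> \<le> q * H ^ 3" for P Q p q
    unfolding abs_mult[of g] using g that
    by (intro mult_mono abs_lin_comb_le) (auto simp: M_def)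
  have "\<bar>304 * Y ^ 7\<bar> \<le> 304 * ((95 * H ^ 3 + 98 * H ^ 3) * M)"
    unfolding double_resultant(1)[of Y X] num den mult.left_commute[of _ g] distrib_left[symmetric]
    by (rule bound) (use monomials in linarith)+
  moreover have "\<bar>19 * X ^ 7\<bar> \<le> 304 * ((95 * H ^ 3 + 119 * H ^ 3) * M)"
    unfolding double_resultant(2)[of X Y] num den mult.left_commute[of _ g] distrib_left[symmetric]
    by (rule bound) (use monomials in linarith)+
  moreover have "H ^ 7 = \<bar>X\<bar> ^ 7 \<or> H ^ 7 = \<bar>Y\<bar> ^ 7" unfolding H_def by (auto simp: max_def)
  moreover have "0 \<le> H ^ 3 * M" by (simp add: H_def M_def)
  ultimately have "H ^ 7 \<le> 3424 * (H ^ 3 * M)"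
    by (auto simp: abs_mult power_abs mult.commute[of M])
  then have "H ^ 3 * H ^ 4 \<le> H ^ 3 * (3424 * M)" by (simp flip: power_add)
  moreover have "H > 0" using cop by (auto simp: H_def less_max_iff_disj)
  ultimately have "H ^ 4 \<le> 3424 * M" by (metis mult_le_cancel_left_pos zero_less_power)
  then show ?thesis unfolding H_def M_def .
qed

section \<open>Descent on the curve\<close>

definition trivial_point :: "int \<Rightarrow> int \<Rightarrow> bool" where
  "trivial_point m n \<longleftrightarrow> n = 0 \<or> m = 0 \<or> m = 2 * n"

lemma trivial_point_double:
  assumes "trivial_point X Y" "g \<noteq> 0" "double_num X Y = g * m" "double_den X Y = g * n"
  shows "trivial_point m n"
proof -
  consider (infinite) "Y = 0" | (zero) "X = 0" | (two) "X = 2 * Y"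
    using assms(1) unfolding trivial_point_def by blast
  then show ?thesis
  proof cases
    case infinite
    then show ?thesis using assms(2,3) by (simp add: double_num_def trivial_point_def)
  next
    case zero
    then show ?thesis using assms(2,4) by (simp add: double_den_def trivial_point_def)
  next
    case two
    then have "g * m = 16 * Y ^ 4" "g * n = 8 * Y ^ 4"
      unfolding assms(3,4)[symmetric] double_num_def double_den_def by algebra+
    then have "g * m = g * (2 * n)" by simp
    then show ?thesis using assms(2) by (simp add: trivial_point_def)
  qed
qed

text \<open>The moduli are chosen so that no nontrivial point of height at most 15 survives.\<close>

definition locally_square :: "int \<Rightarrow> bool" where
  "locally_square v \<longleftrightarrow> v \<ge> 0 \<and> (\<forall>p\<in>{7, 9, 11, 17, 47}. v mod p \<in> (\<lambda>k. k * k mod p) ` {0..p - 1})"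

lemma locally_square_square: "locally_square (d\<^sup>2)"
  unfolding locally_square_def by (intro conjI ballI square_mod_image) auto

lemma squares_mod:
  "(\<lambda>k. k * k mod 7) ` {0..6::int} = {0, 1, 2, 4}"
  "(\<lambda>k. k * k mod 9) ` {0..8::int} = {0, 1, 4, 7}"
  "(\<lambda>k. k * k mod 11) ` {0..10::int} = {0, 1, 3, 4, 5, 9}"
  "(\<lambda>k. k * k mod 17) ` {0..16::int} = {0, 1, 2, 4, 8, 9, 13, 15, 16}"
  "(\<lambda>k. k * k mod 47) ` {0..46::int} =
    {0, 1, 2, 3, 4, 6, 7, 8, 9, 12, 14, 16, 17, 18, 21, 24, 25, 27, 28, 32, 34, 36, 37, 42}"
  unfolding set_upto[symmetric] by (auto simp: upto_rec1 simp del: set_upto)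

lemma not_locally_square_iff:
  "\<not> locally_square v \<longleftrightarrow> (if v < 0 then True
     else if v mod 7 \<notin> {0, 1, 2, 4} then True
     else if v mod 9 \<notin> {0, 1, 4, 7} then True
     else if v mod 11 \<notin> {0, 1, 3, 4, 5, 9} then True
     else if v mod 17 \<notin> {0, 1, 2, 4, 8, 9, 13, 15, 16} then True
     else v mod 47 \<notin>
       {0, 1, 2, 3, 4, 6, 7, 8, 9, 12, 14, 16, 17, 18, 21, 24, 25, 27, 28, 32, 34, 36, 37, 42})"
  unfolding locally_square_def squares_mod[symmetric] by auto

lemma curve_minus: "curve (- m) (- n) = curve m n"
  unfolding curve_def by algebra

lemma locally_square_curve_small:
  assumes "\<bar>m\<bar> \<le> 15" "0 < n" "n \<le> 15" "locally_square (curve m n)"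
  shows "m = 0 \<or> m = 2 * n"
proof -
  have intervals: "[1..15::int] = [1, 2, 3, 4, 5, 6, 7, 8, 9, 10, 11, 12, 13, 14, 15]"
    "[-15..15::int] = [-15, -14, -13, -12, -11, -10, -9, -8, -7, -6, -5, -4, -3, -2, -1,
      0, 1, 2, 3, 4, 5, 6, 7, 8, 9, 10, 11, 12, 13, 14, 15]"
    by (simp_all add: upto_rec1)
  have search: "list_all (\<lambda>n. list_all (\<lambda>m. if m = 0 then True else if m = 2 * n then True
      else \<not> locally_square (curve m n)) [-15..15]) [1..15]"
    unfolding intervals list.pred_inject
    by (intro conjI TrueI; simp add: curve_def; simp add: not_locally_square_iff)
  have "m \<in> {-15..15}" "n \<in> {1..15}" using assms(1-3) by auto
  then show ?thesis using search assms(4) unfolding list_all_iff set_upto by metis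
qed

lemma curve_points_small:
  assumes "\<bar>m\<bar> \<le> 15" "\<bar>n\<bar> \<le> 15" "curve m n = W\<^sup>2"
  shows "trivial_point m n"
proof -
  have locally_square: "locally_square (curve m n)"
    unfolding assms(3) by (rule locally_square_square)
  consider (zero) "n = 0" | (positive) "n > 0" | (negative) "n < 0" by linarith
  then show ?thesis
  proof cases
    case zero
    then show ?thesis by (simp add: trivial_point_def)
  next
    case positive
    then show ?thesis
      using locally_square_curve_small[of m n] locally_square assms(1,2)
      by (auto simp: trivial_point_def)
  next
    case negative
    then show ?thesis
      using locally_square_curve_small[of "- m" "- n"] locally_square assms(1,2)
      by (auto simp: trivial_point_def curve_minus)
  qed
qed

lemma abs_eq_gcd_times_square:
  fixes a b w :: int
  assumes "a * b = w\<^sup>2" "a \<noteq> 0"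
  obtains x where "\<bar>a\<bar> = gcd a b * x\<^sup>2"
proof -
  let ?g = "gcd a b"
  have "?g\<^sup>2 dvd a * b" by (simp add: power2_eq_square mult_dvd_mono)
  then have "?g dvd w" unfolding assms(1) by simp
  then have "?g dvd gcd a w" by simp
  then obtain x where x: "gcd a w = ?g * x" by (elim dvdE)
  have "?g * (?g * x\<^sup>2) = (gcd a w)\<^sup>2" unfolding x by (simp add: power2_eq_square)
  also have "\<dots> = gcd (a * a) (a * b)"
    unfolding assms(1) by (simp add: gcd_exp power2_eq_square[of a, symmetric])
  also have "\<dots> = ?g * \<bar>a\<bar>" by (simp add: gcd_mult_left abs_mult)
  finally show thesis using that[of x] assms(2) by simp
qed

lemma square_product_split:
  fixes a b w :: int
  assumes nz: "a \<noteq> 0" "b \<noteq> 0" and square: "a * b = w\<^sup>2" and gcd: "gcd a b dvd 2 ^ k"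
  obtains \<sigma> c x y where "\<sigma> = 1 \<or> \<sigma> = - 1" "c = 1 \<or> c = 2" "\<sigma> * a = c * x\<^sup>2" "\<sigma> * b = c * y\<^sup>2"
proof -
  obtain j where j: "gcd a b = 2 ^ j"
    using divides_primepow[OF _ gcd] by auto
  obtain x y where xy: "\<bar>a\<bar> = 2 ^ j * x\<^sup>2" "\<bar>b\<bar> = 2 ^ j * y\<^sup>2"
    using abs_eq_gcd_times_square[OF square nz(1)] abs_eq_gcd_times_square[of b a w] square nz(2) j
    by (metis gcd.commute mult.commute)
  define c where "c = (if even j then 1 else 2 :: int)"
  have j_split: "2 ^ j = c * (2 ^ (j div 2))\<^sup>2"
    by (cases "even j") (auto elim!: evenE oddE simp: c_def simp flip: power_mult)
  have "0 \<le> a * b" unfolding square by simp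
  then have "sgn a = sgn b" using nz by (auto simp: zero_le_mult_iff)
  then have "sgn a * a = \<bar>a\<bar>" "sgn a * b = \<bar>b\<bar>" by (simp_all add: abs_sgn mult.commute)
  then have "sgn a * a = c * (2 ^ (j div 2) * x)\<^sup>2" "sgn a * b = c * (2 ^ (j div 2) * y)\<^sup>2"
    unfolding xy j_split by (simp_all add: power_mult_distrib)
  moreover have "sgn a = 1 \<or> sgn a = - 1" using nz(1) by (auto simp: sgn_if)
  ultimately show thesis using that[of "sgn a" c] by (simp add: c_def)
qed

lemma gcd_curve_factors_dvd:
  assumes "coprime m n"
  shows "gcd (m - 2 * n) (cnorm (lin m n)) dvd 2 ^ 4"
proof -
  let ?g = "gcd (m - 2 * n) (cnorm (lin m n))"
  have "16 * n ^ 3 = cnorm (lin m n) - (m - 2 * n) * (m\<^sup>2 + 2 * m * n + 9 * n\<^sup>2)"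
    by (simp add: algebra_simps power2_eq_square power3_eq_cube)
  also have "?g dvd \<dots>" by (intro dvd_diff) auto
  finally have "?g dvd 16 * n ^ 3" .
  moreover have "coprime ?g n"
  proof (rule coprimeI)
    fix d assume "d dvd ?g" "d dvd n"
    then have "d dvd (m - 2 * n) + 2 * n" by (intro dvd_add) auto
    then have "d dvd m" by simp
    then show "is_unit d" using assms \<open>d dvd n\<close> coprime_common_divisor by blast
  qed
  ultimately show ?thesis by (simp add: coprime_dvd_mult_left_iff)
qed

lemma curve_descent_step:
  assumes cop: "coprime m n" and V: "curve m n = V\<^sup>2" and nontrivial: "\<not> trivial_point m n"
  obtains X Y W where "coprime X Y" "curve X Y = W\<^sup>2" "\<not> trivial_point X Y"
    "max \<bar>X\<bar> \<bar>Y\<bar> ^ 4 \<le> 3424 * max \<bar>m\<bar> \<bar>n\<bar>"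
proof -
  have nz: "m - 2 * n \<noteq> 0" "cnorm (lin m n) \<noteq> 0"
    using nontrivial unfolding cnorm_eq_0_iff by (auto simp: trivial_point_def zero_cubic_def)
  have product: "(m - 2 * n) * cnorm (lin m n) = V\<^sup>2"
    unfolding V[symmetric] curve_def by simp
  obtain \<sigma> c \<delta> s where \<sigma>: "\<sigma> = 1 \<or> \<sigma> = - 1" and c: "c = 1 \<or> c = 2"
    and factors: "\<sigma> * (m - 2 * n) = c * \<delta>\<^sup>2" "\<sigma> * cnorm (lin m n) = c * s\<^sup>2"
    using square_product_split[OF nz product gcd_curve_factors_dvd[OF cop]] .
  define m' n' where "m' = \<sigma> * m" and "n' = \<sigma> * n"
  have cop': "coprime m' n'" using cop \<sigma> by (auto simp: m'_def n'_def)
  have nontrivial': "\<not> trivial_point m' n'"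
    using nontrivial \<sigma> by (auto simp: trivial_point_def m'_def n'_def)
  have \<delta>: "m' - 2 * n' = c * \<delta>\<^sup>2"
    unfolding factors(1)[symmetric] m'_def n'_def by (simp add: algebra_simps)
  have norm: "cnorm (lin m' n') = c * s\<^sup>2"
    unfolding factors(2)[symmetric] m'_def n'_def using \<sigma> by auto
  obtain b L e where square: "L \<noteq> 0" "b\<^sup>2 = lin (L * m') (L * n')" "L * m' - 2 * (L * n') = e\<^sup>2"
    using lin_multiple_square[OF cop' c norm \<delta>] .
  have "n' \<noteq> 0" using nontrivial' by (simp add: trivial_point_def)
  then obtain X Y g W where XY: "coprime X Y" "curve X Y = W\<^sup>2" and "g \<noteq> 0"
    and double: "double_num X Y = g * m'" "double_den X Y = g * n'"
    by (rule halving[OF cop' _ square])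
  have "\<not> trivial_point X Y"
    using trivial_point_double[OF _ \<open>g \<noteq> 0\<close> double] nontrivial' by blast
  moreover have "max \<bar>X\<bar> \<bar>Y\<bar> ^ 4 \<le> 3424 * max \<bar>m\<bar> \<bar>n\<bar>"
    using double_height[OF XY(1) double] \<sigma> by (auto simp: m'_def n'_def)
  ultimately show thesis using that XY by blast
qed

lemma curve_points:
  assumes "coprime m n" "curve m n = V\<^sup>2"
  shows "trivial_point m n"
  using assms
proof (induction "nat (max \<bar>m\<bar> \<bar>n\<bar>)" arbitrary: m n V rule: less_induct)
  case less
  show ?case
  proof (rule ccontr)
    assume nontrivial: "\<not> trivial_point m n"
    obtain X Y W where XY: "coprime X Y" "curve X Y = W\<^sup>2" "\<not> trivial_point X Y"
      and height: "max \<bar>X\<bar> \<bar>Y\<bar> ^ 4 \<le> 3424 * max \<bar>m\<bar> \<bar>n\<bar>"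
      using curve_descent_step[OF less.prems nontrivial] .
    define H M where "H = max \<bar>X\<bar> \<bar>Y\<bar>" and "M = max \<bar>m\<bar> \<bar>n\<bar>"
    have "\<not> nat H < nat M"
      using less.hyps[OF _ XY(1,2)] XY(3) unfolding H_def M_def by blast
    moreover have "0 \<le> H" by (simp add: H_def le_max_iff_disj)
    ultimately have "M \<le> H" by linarith
    have "H < 16"
    proof (rule ccontr)
      assume "\<not> H < 16"
      then have "16 ^ 3 * H \<le> H ^ 3 * H" by (intro mult_right_mono power_mono) auto
      moreover have "H ^ 3 * H = H ^ 4" by (simp add: power3_eq_cube power4_eq_xxxx)
      ultimately show False
        using height \<open>M \<le> H\<close> \<open>\<not> H < 16\<close> unfolding H_def[symmetric] M_def[symmetric] by simp
    qed
    then have "\<bar>m\<bar> \<le> 15" "\<bar>n\<bar> \<le> 15" using \<open>M \<le> H\<close> by (auto simp: M_def)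
    then show False using curve_points_small less.prems(2) nontrivial by blast
  qed
qed

lemma int_square_of_rat_square:
  fixes w :: rat
  assumes "w\<^sup>2 = of_int k"
  obtains r where "k = r\<^sup>2"
proof -
  have "algebraic_int w"
    by (rule algebraic_int_root[of "of_int k" "monom 1 2"])
      (simp_all add: assms poly_monom degree_monom_eq)
  moreover have "w \<in> \<rat>" by (metis Rats_of_rat of_rat_eq_id id_apply)
  ultimately obtain r where "w = of_int r"
    using rational_algebraic_int_is_int by (auto elim: Ints_cases)
  then have "k = r\<^sup>2" using assms by (metis of_int_eq_iff of_int_power)
  then show thesis by (rule that)
qed

lemma rational_curve_points:
  fixes u v :: rat
  assumes "v\<^sup>2 = (u - 2) * (u ^ 3 + 5 * u - 2)"
  shows "u = 0 \<or> u = 2"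
proof -
  obtain m n where "quotient_of u = (m, n)" by (cases "quotient_of u")
  then have n: "n > 0" "coprime m n" and u: "u = of_int m / of_int n"
    using quotient_of_denom_pos quotient_of_coprime quotient_of_div by blast+
  have "(v * (of_int n)\<^sup>2)\<^sup>2 = (u - 2) * (u ^ 3 + 5 * u - 2) * (of_int n) ^ 4"
    unfolding power_mult_distrib assms by simp
  also have "\<dots> = of_int (curve m n)"
    unfolding u curve_def using n(1)
    by (simp add: field_simps power2_eq_square power3_eq_cube power4_eq_xxxx)
  finally obtain V where "curve m n = V\<^sup>2" by (rule int_square_of_rat_square)
  then have "m = 0 \<or> m = 2 * n" using curve_points n unfolding trivial_point_def by fastforce
  then show ?thesis using n by (auto simp: u)
qed

section \<open>Quadratic factors\<close>

lemma quadratic_dvd_remainder: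
  fixes p q r0 r1 :: "'a::field"
  assumes "[:q, p, 1:] dvd f" "f = [:q, p, 1:] * g + [:r0, r1:]"
  shows "r0 = 0" "r1 = 0"
proof -
  have "[:q, p, 1:] dvd [:r0, r1:]" using assms by (metis dvd_add_right_iff dvd_triv_left)
  then have "[:r0, r1:] = 0 \<or> degree [:q, p, 1:] \<le> degree [:r0, r1:]"
    using dvd_imp_degree_le by blast
  then have "[:r0, r1:] = 0" by (auto split: if_splits)
  then show "r0 = 0" "r1 = 0" by auto
qed

lemma dvd_of_dvd_linear_mult:
  fixes d g :: "'a::field poly"
  assumes "poly d x \<noteq> 0" "d dvd [:- x, 1:] * g"
  shows "d dvd g"
proof -
  have "smult (poly d x) g = d * g - synthetic_div d x * ([:- x, 1:] * g)"
    by (subst (2) synthetic_div_correct'[of x d, symmetric]) (simp add: algebra_simps)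
  also have "d dvd \<dots>" by (intro dvd_diff dvd_mult[OF assms(2)] dvd_triv_left)
  finally show ?thesis using assms(1) by (simp add: dvd_smult_iff)
qed

lemma quintic_remainder_nondegenerate:
  fixes a p q :: rat
  assumes a: "a \<noteq> 0"
    and r1: "p ^ 4 - 3 * p\<^sup>2 * q + q\<^sup>2 + 1 = a * p"
    and r0: "a * (q - 1) = p * q * (p\<^sup>2 - 2 * q)"
  shows "q \<noteq> 1"
proof
  assume q: "q = 1"
  have "p \<noteq> 0" using r1 q by auto
  then have "p\<^sup>2 = 2" using r0 q by simp
  moreover have "a * p = p\<^sup>2 * p\<^sup>2 - 3 * p\<^sup>2 + 2"
    using r1 q by (simp add: power2_eq_square power4_eq_xxxx)
  ultimately have "a * p = 0" by simp
  then show False using a \<open>p \<noteq> 0\<close> by simp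
qed

text \<open>The equations become a quadratic in $t$ over $\mathbb{Q}(u)$; the curve says that its
  discriminant is a square.\<close>

lemma quintic_remainder_no_solution:
  fixes a p q :: rat
  assumes a: "a \<noteq> 0"
    and r1: "p ^ 4 - 3 * p\<^sup>2 * q + q\<^sup>2 + 1 = a * p"
    and r0: "a * (q - 1) = p * q * (p\<^sup>2 - 2 * q)"
  shows False
proof -
  define t where "t = q - 1"
  define u where "u = (t\<^sup>2 + p\<^sup>2 - 2) / t"
  have t: "t \<noteq> 0" using quintic_remainder_nondegenerate[OF assms] by (simp add: t_def)
  then have p2: "p\<^sup>2 = u * t + 2 - t\<^sup>2" by (simp add: u_def)
  have q: "q = t + 1" by (simp add: t_def)
  have "(p ^ 4 - 3 * p\<^sup>2 * q + q\<^sup>2 + 1) * (q - 1) = p\<^sup>2 * q * (p\<^sup>2 - 2 * q)"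
    unfolding r1 using r0 by algebra
  then have "t * t * (u * t\<^sup>2 + (u - u\<^sup>2 + 2) * t + 4 - 2 * u) = 0"
    using p2 unfolding q by algebra
  then have quadratic: "u * t\<^sup>2 + (u - u\<^sup>2 + 2) * t + 4 - 2 * u = 0" using t by simp
  then have "(2 * u * t + (u - u\<^sup>2 + 2))\<^sup>2 = (u - 2) * (u ^ 3 + 5 * u - 2)" by algebra
  then consider (zero) "u = 0" | (two) "u = 2" using rational_curve_points by blast
  then show False
  proof cases
    case zero
    then have "t = - 2" using quadratic by simp
    then have "p\<^sup>2 = - 2" using p2 zero by simp
    then show False using zero_le_power2[of p] by linarith
  next
    case two
    then show False using quadratic t by simp
  qed
qed

lemma quadratic_not_dvd_quintic:
  fixes a p q :: rat
  assumes "a \<noteq> 0"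
  shows "\<not> [:q, p, 1:] dvd monom 1 5 + monom a 2 + monom 1 1 + [:a:]"
proof
  assume dvd: "[:q, p, 1:] dvd monom 1 5 + monom a 2 + monom 1 1 + [:a:]"
  let ?c = "a - p ^ 3 + 2 * p * q"
  have "monom 1 5 + monom a 2 + monom 1 1 + [:a:] = [:q, p, 1:] * [:?c, p\<^sup>2 - q, - p, 1:]
      + [:a - q * ?c, 1 - p * ?c - q * (p\<^sup>2 - q):]"
    by (simp add: monom_Suc numeral_eq_Suc monom_0 algebra_simps power2_eq_square power3_eq_cube)
  from quadratic_dvd_remainder[OF dvd this]
  have "p ^ 4 - 3 * p\<^sup>2 * q + q\<^sup>2 + 1 = a * p" "a * (q - 1) = p * q * (p\<^sup>2 - 2 * q)"
    by algebra+
  then show False by (rule quintic_remainder_no_solution[OF assms])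
qed

lemma two_not_rat_square: "(p :: rat)\<^sup>2 \<noteq> 2"
proof
  assume "p\<^sup>2 = 2"
  then obtain r :: int where "2 = r\<^sup>2" using int_square_of_rat_square[of p 2] by auto
  then show False using square_mod_16[of r] by simp
qed

lemma quadratic_not_dvd_quartic:
  fixes p q :: rat
  shows "\<not> [:q, p, 1:] dvd monom 1 4 + 1"
proof
  assume dvd: "[:q, p, 1:] dvd monom 1 4 + 1"
  have "monom 1 4 + 1 = [:q, p, 1:] * [:p\<^sup>2 - q, - p, 1:]
      + [:1 - q * (p\<^sup>2 - q), p * q - p * (p\<^sup>2 - q):]"
    by (simp add: monom_Suc numeral_eq_Suc monom_0 algebra_simps power2_eq_square one_pCons)
  from quadratic_dvd_remainder[OF dvd this]
  have r0: "q\<^sup>2 - p\<^sup>2 * q + 1 = 0" and "p * (2 * q - p\<^sup>2) = 0" by algebra+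
  then consider (even) "p = 0" | (square) "p\<^sup>2 = 2 * q" by auto
  then show False
  proof cases
    case even
    then have "q\<^sup>2 + 1 = 0" using r0 by simp
    then show False using zero_le_power2[of q] by linarith
  next
    case square
    then have "q\<^sup>2 = 1" using r0 by (simp add: power2_eq_square)
    moreover have "q \<ge> 0" using square zero_le_power2[of p] by linarith
    ultimately have "q = 1" by (simp add: power2_eq_1_iff)
    then show False using square two_not_rat_square[of p] by simp
  qed
qed

lemma quadratic_not_dvd_reducible_quintic:
  fixes a p q :: rat
  shows "\<not> [:q, p, 1:] dvd monom 1 5 + monom a 4 + monom 1 1 + [:a:]"
proof
  assume "[:q, p, 1:] dvd monom 1 5 + monom a 4 + monom 1 1 + [:a:]"
  also have "monom 1 5 + monom a 4 + monom 1 1 + [:a:] = [:- (- a), 1:] * (monom 1 4 + 1)"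
    by (simp add: monom_Suc numeral_eq_Suc monom_0 one_pCons)
  finally have dvd: "[:q, p, 1:] dvd [:- (- a), 1:] * (monom 1 4 + 1)" .
  show False
  proof (cases "poly [:q, p, 1:] (- a) = 0")
    case True
    then have "[:q, p, 1:] = [:- (- a), 1:] * [:p - a, 1:]" by (simp add: algebra_simps)
    then have "[:- (a - p), 1:] dvd monom 1 4 + 1"
      using dvd by (simp only: dvd_mult_cancel_left) auto
    then have "poly (monom 1 4 + 1) (a - p) = 0" by (simp only: poly_eq_0_iff_dvd)
    then have "(a - p) ^ 4 + 1 = 0" by (simp add: poly_monom)
    moreover have "(a - p) ^ 4 \<ge> 0" by simp
    ultimately show False by linarith
  next
    case False
    then show False using dvd_of_dvd_linear_mult[OF _ dvd] quadratic_not_dvd_quartic by blast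
  qed
qed

theorem theorem3p3:
  fixes a :: rat
  assumes "a \<noteq> 0"
  shows "\<not> has_quadratic_factor (monom 1 5 + monom a 2 + monom 1 1 + [:a:])
    \<and> \<not> has_quadratic_factor (monom 1 5 + monom a 4 + monom 1 1 + [:a:])"
  unfolding has_quadratic_factor_def
  using quadratic_not_dvd_quintic[OF assms] quadratic_not_dvd_reducible_quintic by blast

end
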